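(* Let $Z$ be an offspring distribution with $1<\mathbb{E}(Z)<\infty$ and $\mathbb{P}(Z=0)=0$. On an almost sure sample of the Galton–Watson tree $(T_{\mathrm{GW}},\rho)$ with offspring distribution $Z$, or of the unimodular Galton–Watson tree $(T_{\mathrm{UGW}},\rho)$, the loop contracting random walk (LCRW) is transient from every vertex almost surely.
   Context: $(T_{\mathrm{GW}},\rho)$ is the Galton–Watson tree rooted at its ancestor with offspring law $Z$. The augmented Galton–Watson tree $(T_{\mathrm{AGW}},\rho)$ is obtained by letting the root have $Z+1$ children (instead of $Z$), each of which independently generates a Galton–Watson tree with offspring law $Z$ (equivalently, join the roots of two independent copies of $T_{\mathrm{GW}}$ by an edge and root at one endpoint); $(T_{\mathrm{UGW}},\rho)$ is the law of $T_{\mathrm{AGW}}$ biased by $1/\deg(\rho)$ (normalized). Contraction of an oriented cycle $C$ in a multigraph: remove the vertices of $C$ and all oriented edges with both endpoints in $C$, add a new vertex $v_C$, and replace each oriented edge with exactly one endpoint in $C$ by the edge with that endpoint replaced by $v_C$. LCRW on an infinite graph $G$ started at $x$: a random sequence $(G_i,P_i,X_i)_{i\ge0}$ with $G_0=G$, $P_0$ the empty path at $x$, $X_0=x$; at each step choose uniformly at random (with multiplicity, independently) an outgoing oriented edge $\vec e$ of $X_i$ in $G_i$. If the head of $\vec e$ is a vertex $y$ on the simple path $P_i$, contract the cycle formed by the part of $P_i$ from $y$ to $X_i$ and $\vec e$ to get $G_{i+1}$, truncate $P_i$ at $y$ to get $P_{i+1}$ (now ending at the new vertex $v_C$), and set $X_{i+1}=v_C$;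 otherwise $G_{i+1}=G_i$, $P_{i+1}=P_i$ extended by $\vec e$, $X_{i+1}$ the head of $\vec e$. The LCRW is transient from $x$ if a.s. $P_i$ converges to an infinite path (every initial segment is eventually constant and the length tends to infinity). *)

theory Defs
  imports "HOL-Probability.Probability"
begin

text \<open>A rooted tree is encoded by a child-count function c on Ulam--Harris labels
(nat lists): the root is [], and the children of v are v@[i] for i < c v.\<close>

inductive_set tree_vertices :: "(nat list \<Rightarrow> nat) \<Rightarrow> nat list set"
  for c :: "nat list \<Rightarrow> nat" where
  root: "[] \<in> tree_vertices c"
| child: "v \<in> tree_vertices c \<Longrightarrow> i < c v \<Longrightarrow> v @ [i] \<in> tree_vertices c"

definition tree_adj :: "(nat list \<Rightarrow> nat) \<Rightarrow> nat list \<Rightarrow> nat list \<Rightarrow> bool" where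
  "tree_adj c u v \<longleftrightarrow>
     (u \<in> tree_vertices c \<and> (\<exists>i<c u. v = u @ [i])) \<or>
     (v \<in> tree_vertices c \<and> (\<exists>i<c v. u = v @ [i]))"

definition GW_measure :: "nat pmf \<Rightarrow> (nat list \<Rightarrow> nat) measure" where
  "GW_measure Z = (\<Pi>\<^sub>M v\<in>(UNIV :: nat list set). measure_pmf Z)"

definition agw_children :: "(nat list \<Rightarrow> nat) \<Rightarrow> nat list \<Rightarrow> nat" where
  "agw_children N = N([] := Suc (N []))"

definition root_degree :: "(nat list \<Rightarrow> nat) \<Rightarrow> nat" where
  "root_degree c = card {v. tree_adj c [] v}"

definition AGW_measure :: "nat pmf \<Rightarrow> (nat list \<Rightarrow> nat) measure" where
  "AGW_measure Z = GW_measure Z"   \<comment> \<open>sample N, the tree is agw_children N\<close>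

definition ugw_const :: "nat pmf \<Rightarrow> real" where
  "ugw_const Z = (\<integral>N. 1 / real (root_degree (agw_children N)) \<partial>AGW_measure Z)"

definition UGW_measure :: "nat pmf \<Rightarrow> (nat list \<Rightarrow> nat) measure" where
  "UGW_measure Z = density (AGW_measure Z)
     (\<lambda>N. ennreal (1 / (real (root_degree (agw_children N)) * ugw_const Z)))"

text \<open>State: a partition of the vertices into contracted blocks (cls v = block of v)
 and the current simple path, a list of oriented edges of the original graph
 (oriented edges of the contracted graph G_i are exactly the original oriented edges
 between distinct blocks). Blocks along the path: cls x, cls(head e_1), ...\<close>

definition outs :: "('v \<Rightarrow> 'v \<Rightarrow> bool) \<Rightarrow> 'v set \<Rightarrow> ('v \<times> 'v) set" where
  "outs E B = {(u, w). u \<in> B \<and> E u w \<and> w \<notin> B}"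

definition path_blocks :: "('v \<Rightarrow> 'v set) \<Rightarrow> 'v \<Rightarrow> ('v \<times> 'v) list \<Rightarrow> 'v set list" where
  "path_blocks cls x p = cls x # map (\<lambda>e. cls (snd e)) p"

definition enum_list :: "'a set \<Rightarrow> 'a list" where
  "enum_list S = (SOME xs. distinct xs \<and> set xs = S)"

text \<open>Uniform choice from a finite nonempty set S driven by a uniform u in [0,1).\<close>
definition pick :: "'a set \<Rightarrow> real \<Rightarrow> 'a" where
  "pick S u = enum_list S ! nat \<lfloor>u * real (card S)\<rfloor>"

definition lcrw_step :: "('v \<Rightarrow> 'v \<Rightarrow> bool) \<Rightarrow> 'v \<Rightarrow> ('v \<Rightarrow> 'v set) \<times> ('v \<times> 'v) list
      \<Rightarrow> real \<Rightarrow> ('v \<Rightarrow> 'v set) \<times> ('v \<times> 'v) list" where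
  "lcrw_step E x st u =
     (let cls = fst st; p = snd st; bs = path_blocks cls x p; S = outs E (last bs) in
      if S = {} \<or> infinite S then st else
      let e = pick S u in
      if cls (snd e) \<in> set bs then
        (let j = (LEAST j. j < length bs \<and> bs ! j = cls (snd e));
             C = \<Union> (set (drop j bs)) in
         ((\<lambda>v. if v \<in> C then C else cls v), take j p))
      else (cls, p @ [e]))"

primrec lcrw_state :: "('v \<Rightarrow> 'v \<Rightarrow> bool) \<Rightarrow> 'v \<Rightarrow> real stream \<Rightarrow> nat
      \<Rightarrow> ('v \<Rightarrow> 'v set) \<times> ('v \<times> 'v) list" where
  "lcrw_state E x \<omega> 0 = ((\<lambda>v. {v}), [])"
| "lcrw_state E x \<omega> (Suc n) = lcrw_step E x (lcrw_state E x \<omega> n) (\<omega> !! n)"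

definition unif_stream :: "real stream measure" where
  "unif_stream = stream_space (uniform_measure lborel {0..<1})"

definition path_converges :: "(nat \<Rightarrow> 'a list) \<Rightarrow> bool" where
  "path_converges P \<longleftrightarrow> (\<forall>k. \<exists>n0. \<forall>n\<ge>n0. k \<le> length (P n) \<and> take k (P n) = take k (P n0))"

definition lcrw_transient :: "('v \<Rightarrow> 'v \<Rightarrow> bool) \<Rightarrow> 'v \<Rightarrow> bool" where
  "lcrw_transient E x \<longleftrightarrow>
     (AE \<omega> in unif_stream. path_converges (\<lambda>n. snd (lcrw_state E x \<omega> n)))"

end

theory Submission
  imports Defs
begin

text \<open>On a tree all contracted vertices lie on the blocks of the current path, and the tip block has
  exactly one edge back to the previous block. So with \<open>f\<close> unexplored edges at the tip, the walk
  merges the last two blocks with probability \<open>1/(f+1)\<close> (the numbers \<open>f\<close> add up) and otherwise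
  uses up one unexplored edge and reveals a fresh vertex with \<open>Z\<close> new edges: averaged over the tree, the
  stack of numbers \<open>f\<close> is a Markov chain.

  If every unexplored edge of a block carried an exponential clock, the back edge would ring at an
  exponential time and until then the edges would branch. The generating function \<open>g\<close> of the size of a
  block at the time it is merged away therefore solves \<open>g'(s) (s - g(s)) = h(s) - g(s)\<close>, with \<open>h\<close> the
  generating function of \<open>Z\<close>; for \<open>\<delta> = s - g\<close> this is \<open>\<delta> \<delta>' = s - h\<close>, so the return
  probability \<open>g(1)\<close> is less than \<open>1\<close>. The quadratic \<open>s - \<kappa> s (1 - s/2)\<close> with
  \<open>\<kappa> = 1 - P(Z = 1)\<close> is a supersolution, and the corresponding branching process is explicit. It
  gives a bounded Lyapunov function showing that the expected number of visits of the path length to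
  any fixed value is finite.\<close>

section \<open>Superharmonic bounds for returning\<close>

text \<open>The branching flow \<open>dy/du = -\<kappa> y (1 - y/2)\<close> is linearised by \<open>y = ypar r\<close>, \<open>dr/du = -\<kappa> r\<close>.
  Writing the exponential time as \<open>u = - ln t\<close> with \<open>t\<close> uniform on \<open>[0,1]\<close> turns \<open>\<rho>\<close> into
  \<open>\<rho> t\<^sup>\<kappa>\<close>. Stacks are listed from the bottom; \<open>merge_bound gs f\<close> is the value of the
  stack \<open>gs @ [f]\<close> after its top has been merged, where for empty \<open>gs\<close> the top is absorbed
  by the block below the stack, with weight \<open>s^f\<close>, \<open>s = ypar \<rho>\<close>.\<close>

definition ypar :: "real \<Rightarrow> real" where
  "ypar r = 2 * r / (1 + r)"

definition gbd :: "real \<Rightarrow> real \<Rightarrow> real" where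
  "gbd \<kappa> y = y - \<kappa> * y * (1 - y / 2)"

definition level_int :: "real \<Rightarrow> (real \<Rightarrow> ennreal) \<Rightarrow> real \<Rightarrow> ennreal" where
  "level_int \<kappa> \<phi> \<rho> = (\<integral>\<^sup>+t. \<phi> (\<rho> * t powr \<kappa>) * indicator {0..1} t \<partial>lborel)"

primrec ret_bound :: "real \<Rightarrow> nat list \<Rightarrow> real \<Rightarrow> ennreal" where
  "ret_bound \<kappa> [] \<rho> = 1"
| "ret_bound \<kappa> (f # fs) \<rho> = level_int \<kappa> (\<lambda>r. ennreal (ypar r ^ f) * ret_bound \<kappa> fs r) \<rho>"

primrec merge_bound :: "real \<Rightarrow> nat list \<Rightarrow> nat \<Rightarrow> real \<Rightarrow> ennreal" where
  "merge_bound \<kappa> [] f \<rho> = ennreal (ypar \<rho> ^ f)"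
| "merge_bound \<kappa> (g # gs) f \<rho> = level_int \<kappa> (\<lambda>r. ennreal (ypar r ^ g) * merge_bound \<kappa> gs f r) \<rho>"

lemma ypar_bounds: "0 \<le> r \<Longrightarrow> 0 \<le> ypar r" "0 \<le> r \<Longrightarrow> r \<le> 1 \<Longrightarrow> ypar r \<le> 1"
  by (auto simp: ypar_def field_simps)

lemma ypar_1 [simp]: "ypar 1 = 1"
  by (simp add: ypar_def)

lemma measurable_ypar [measurable]: "ypar \<in> borel_measurable borel"
  unfolding ypar_def by measurable

lemma measurable_gbd [measurable]: "gbd \<kappa> \<in> borel_measurable borel"
  unfolding gbd_def by measurable

lemma measurable_level_int [measurable]:
  assumes [measurable]: "\<phi> \<in> borel_measurable borel"
  shows "level_int \<kappa> \<phi> \<in> borel_measurable borel"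
  unfolding level_int_def by measurable

lemma measurable_ret_bound [measurable]: "ret_bound \<kappa> fs \<in> borel_measurable borel"
  by (induction fs) (auto simp: ret_bound.simps cong: measurable_cong)

lemma measurable_merge_bound [measurable]: "merge_bound \<kappa> fs f \<in> borel_measurable borel"
proof (induction fs)
  case Nil
  show ?case unfolding merge_bound.simps by measurable
qed (auto simp: merge_bound.simps)

lemma radius_bounds:
  fixes \<rho> t \<kappa> :: real
  assumes "0 \<le> \<rho>" "\<rho> \<le> 1" "0 < \<kappa>" "0 \<le> t" "t \<le> 1"
  shows "0 \<le> \<rho> * t powr \<kappa>" "\<rho> * t powr \<kappa> \<le> 1"
proof -
  have "t powr \<kappa> \<le> 1 powr \<kappa>" using assms by (intro powr_mono2) auto
  then show "\<rho> * t powr \<kappa> \<le> 1" using assms mult_mono[of \<rho> 1 "t powr \<kappa>" 1] by auto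
qed (use assms in auto)

lemma level_int_mono:
  assumes "0 \<le> \<rho>" "\<rho> \<le> 1" "0 < \<kappa>" "\<And>r. 0 \<le> r \<Longrightarrow> r \<le> 1 \<Longrightarrow> \<phi> r \<le> \<psi> r"
  shows "level_int \<kappa> \<phi> \<rho> \<le> level_int \<kappa> \<psi> \<rho>"
  unfolding level_int_def
proof (rule nn_integral_mono)
  fix t :: real
  show "\<phi> (\<rho> * t powr \<kappa>) * indicator {0..1} t \<le> \<psi> (\<rho> * t powr \<kappa>) * indicator {0..1} t"
    using assms(4) radius_bounds[OF assms(1-3), of t] by (auto simp: indicator_def)
qed

lemma level_int_cong:
  assumes "0 \<le> \<rho>" "\<rho> \<le> 1" "0 < \<kappa>" "\<And>r. 0 \<le> r \<Longrightarrow> r \<le> 1 \<Longrightarrow> \<phi> r = \<psi> r"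
  shows "level_int \<kappa> \<phi> \<rho> = level_int \<kappa> \<psi> \<rho>"
  using assms by (intro antisym level_int_mono) auto

lemma level_int_add:
  assumes [measurable]: "\<phi> \<in> borel_measurable borel" "\<psi> \<in> borel_measurable borel"
  shows "level_int \<kappa> (\<lambda>r. \<phi> r + \<psi> r) \<rho> = level_int \<kappa> \<phi> \<rho> + level_int \<kappa> \<psi> \<rho>"
  unfolding level_int_def by (subst nn_integral_add[symmetric]) (auto simp: distrib_right)

lemma level_int_cmult:
  assumes [measurable]: "\<phi> \<in> borel_measurable borel"
  shows "level_int \<kappa> (\<lambda>r. c * \<phi> r) \<rho> = c * level_int \<kappa> \<phi> \<rho>"
  unfolding level_int_def by (subst nn_integral_cmult[symmetric]) (auto simp: mult.assoc)

lemma level_int_one: "level_int \<kappa> (\<lambda>r. 1) \<rho> = 1"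
  unfolding level_int_def by simp

lemma level_int_nn_integral:
  assumes [measurable]: "\<And>z::nat. \<phi> z \<in> borel_measurable borel"
  shows "(\<integral>\<^sup>+z. level_int \<kappa> (\<phi> z) \<rho> \<partial>measure_pmf Z)
       = level_int \<kappa> (\<lambda>r. \<integral>\<^sup>+z. \<phi> z r \<partial>measure_pmf Z) \<rho>"
proof -
  interpret pair_sigma_finite lborel "measure_pmf Z" ..
  \<comment> \<open>The second variable has countably many values, so measurability in the first one
    for each fixed value suffices.\<close>
  have [measurable]: "(\<lambda>x. \<phi> (snd x) (\<rho> * fst x powr \<kappa>)) \<in> borel_measurable (lborel \<Otimes>\<^sub>M measure_pmf Z)"
    by (rule measurable_compose_countable'[where g=snd and I=UNIV]) (auto simp: measurable_pair_measure_countable1 intro: measurable_compose[OF measurable_snd])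
  have "(\<integral>\<^sup>+z. level_int \<kappa> (\<phi> z) \<rho> \<partial>measure_pmf Z)
     = (\<integral>\<^sup>+t. \<integral>\<^sup>+z. \<phi> z (\<rho> * t powr \<kappa>) * indicator {0..1} t \<partial>measure_pmf Z \<partial>lborel)"
    unfolding level_int_def by (rule Fubini') (simp add: split_beta')
  also have "\<dots> = (\<integral>\<^sup>+t. (\<integral>\<^sup>+z. \<phi> z (\<rho> * t powr \<kappa>) \<partial>measure_pmf Z) * indicator {0..1} t \<partial>lborel)"
    by (intro nn_integral_cong nn_integral_multc) auto
  finally show ?thesis unfolding level_int_def .
qed

text \<open>With \<open>r = \<rho> t\<^sup>\<kappa>\<close> and \<open>y = ypar r\<close> one has \<open>t dy/dt = \<kappa> y (1 - y/2) = y - gbd \<kappa> y\<close>,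
  so the integrand is the derivative of \<open>t \<phi>(y)\<close>.\<close>

lemma level_int_FTC:
  fixes \<phi> \<phi>' :: "real \<Rightarrow> real"
  assumes \<rho>: "0 \<le> \<rho>" "\<rho> \<le> 1" and \<kappa>: "0 < \<kappa>"
    and deriv: "\<And>y. (\<phi> has_real_derivative \<phi>' y) (at y)"
    and nonneg: "\<And>y. 0 \<le> y \<Longrightarrow> y \<le> 1 \<Longrightarrow> 0 \<le> \<phi> y + \<phi>' y * (y - gbd \<kappa> y)"
  shows "level_int \<kappa> (\<lambda>r. ennreal (\<phi> (ypar r) + \<phi>' (ypar r) * (ypar r - gbd \<kappa> (ypar r)))) \<rho>
       = ennreal (\<phi> (ypar \<rho>))"
proof -
  define r where "r t = \<rho> * t powr \<kappa>" for t :: real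
  define F where "F t = t * \<phi> (ypar (r t))" for t
  define D where "D t = \<phi> (ypar (r t)) + \<phi>' (ypar (r t)) * (ypar (r t) - gbd \<kappa> (ypar (r t)))" for t
  have rb: "0 \<le> r t" "r t \<le> 1" if "0 \<le> t" "t \<le> 1" for t
    using radius_bounds[OF \<rho> \<kappa> that] by (auto simp: r_def)
  have "(D has_integral (F 1 - F 0)) {0..1}"
  \<comment> \<open>For \<kappa> < 1 the power of \<open>t\<close> has no finite derivative at 0,
    hence continuity on the closed interval and derivatives only inside.\<close>
  proof (rule fundamental_theorem_of_calculus_interior)
    have c\<phi>: "continuous_on UNIV \<phi>"
      using deriv by (meson DERIV_isCont continuous_at_imp_continuous_on)
    have cr: "continuous_on {0..1} r"
      unfolding r_def using \<kappa> by (intro continuous_intros continuous_on_powr') auto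
    have nz: "1 + r t \<noteq> 0" if "t \<in> {0..1}" for t
      using rb[of t] that by auto
    have cy: "continuous_on {0..1} (\<lambda>t. ypar (r t))"
      unfolding ypar_def using nz by (intro continuous_intros cr) simp
    show "continuous_on {0..1} F"
      unfolding F_def
      by (rule continuous_on_mult[OF continuous_on_id continuous_on_compose2[OF c\<phi> cy subset_UNIV]])
    fix t :: real assume t: "t \<in> {0<..<1}"
    have r': "(r has_real_derivative (\<kappa> * r t / t)) (at t)"
      unfolding r_def using t
      by (auto intro!: derivative_eq_intros simp: powr_diff)
    have nz: "1 + r t \<noteq> 0" using rb[of t] t by auto
    have y': "((\<lambda>t. ypar (r t)) has_real_derivative (2 / (1 + r t)^2 * (\<kappa> * r t / t))) (at t)"
    proof -
      have "((\<lambda>t. ypar (r t)) has_real_derivative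
          ((2 * (\<kappa> * r t / t)) * (1 + r t) - (2 * r t) * (\<kappa> * r t / t)) / ((1 + r t) * (1 + r t))) (at t)"
        unfolding ypar_def using nz by (auto intro!: derivative_eq_intros r')
      also have "((2 * (\<kappa> * r t / t)) * (1 + r t) - (2 * r t) * (\<kappa> * r t / t)) / ((1 + r t) * (1 + r t))
          = 2 / (1 + r t)^2 * (\<kappa> * r t / t)"
        using nz t by (simp add: divide_simps power2_eq_square) (simp add: algebra_simps)
      finally show ?thesis .
    qed
    have e: "t * (2 / (1 + r t)^2 * (\<kappa> * r t / t)) = ypar (r t) - gbd \<kappa> (ypar (r t))"
      using t nz unfolding gbd_def ypar_def by (simp add: divide_simps power2_eq_square)
    have "(F has_real_derivative (1 * \<phi> (ypar (r t))
        + (\<phi>' (ypar (r t)) * (2 / (1 + r t)^2 * (\<kappa> * r t / t))) * t)) (at t)"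
      unfolding F_def by (rule DERIV_mult[OF DERIV_ident DERIV_chain2[OF deriv y']])
    also have "1 * \<phi> (ypar (r t)) + (\<phi>' (ypar (r t)) * (2 / (1 + r t)^2 * (\<kappa> * r t / t))) * t = D t"
      unfolding D_def e[symmetric] by (simp add: algebra_simps)
    finally show "(F has_vector_derivative D t) (at t)"
      by (simp add: has_real_derivative_iff_has_vector_derivative)
  qed auto
  moreover have "0 \<le> D t" if "t \<in> {0..1}" for t
    using that unfolding D_def by (intro nonneg ypar_bounds rb) auto
  ultimately have "(\<integral>\<^sup>+t. ennreal (D t) * indicator {0..1} t \<partial>lborel) = ennreal (F 1 - F 0)"
    by (intro nn_integral_has_integral_lebesgue')
  then show ?thesis
    unfolding level_int_def D_def F_def r_def by simp
qed

lemma gbd_bounds: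
  assumes "0 \<le> \<kappa>" "\<kappa> \<le> 1" "0 \<le> y" "y \<le> 1"
  shows "0 \<le> gbd \<kappa> y" "gbd \<kappa> y \<le> y"
proof -
  have "\<kappa> * (y * (1 - y/2)) \<le> 1 * (y * 1)" using assms by (intro mult_mono) auto
  then show "0 \<le> gbd \<kappa> y" by (simp add: gbd_def mult.assoc)
  have "0 \<le> \<kappa> * y * (1 - y/2)" using assms by auto
  then show "gbd \<kappa> y \<le> y" by (simp add: gbd_def)
qed

text \<open>Apply \<open>level_int_FTC\<close> to the power of exponent \<open>Suc f\<close>. In the
  clock picture this is the exact first-step equation of a lone block with \<open>Suc f\<close>
  unexplored edges, when a fresh block above it is replaced by its return weight
  \<open>gbd\<close>.\<close>

lemma level_int_power:
  assumes \<rho>: "0 \<le> \<rho>" "\<rho> \<le> 1" and \<kappa>: "0 < \<kappa>" "\<kappa> \<le> 1"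
  shows "ennreal (ypar \<rho> ^ Suc f)
      + of_nat (Suc f) * level_int \<kappa> (\<lambda>r. ennreal (ypar r ^ f * gbd \<kappa> (ypar r))) \<rho>
     = of_nat (Suc (Suc f)) * level_int \<kappa> (\<lambda>r. ennreal (ypar r ^ Suc f)) \<rho>"
proof -
  let ?h = "\<lambda>y::real. y ^ Suc f + (real (Suc f) * y ^ f) * (y - gbd \<kappa> y)"
  have h: "0 \<le> ?h y" if "0 \<le> y" "y \<le> 1" for y
    using gbd_bounds[of \<kappa> y] that \<kappa> by auto
  have "level_int \<kappa> (\<lambda>r. ennreal (?h (ypar r))) \<rho> = ennreal (ypar \<rho> ^ Suc f)"
    by (rule level_int_FTC[OF \<rho> \<kappa>(1)]) (auto intro!: derivative_eq_intros h simp del: power_Suc of_nat_Suc)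
  then have "ennreal (ypar \<rho> ^ Suc f)
      + of_nat (Suc f) * level_int \<kappa> (\<lambda>r. ennreal (ypar r ^ f * gbd \<kappa> (ypar r))) \<rho>
    = level_int \<kappa> (\<lambda>r. ennreal (?h (ypar r)) + of_nat (Suc f) * ennreal (ypar r ^ f * gbd \<kappa> (ypar r))) \<rho>"
    by (simp add: level_int_add level_int_cmult)
  also have "\<dots> = level_int \<kappa> (\<lambda>r. of_nat (Suc (Suc f)) * ennreal (ypar r ^ Suc f)) \<rho>"
  proof (rule level_int_cong[OF \<rho> \<kappa>(1)])
    fix r :: real assume "0 \<le> r" "r \<le> 1"
    note y = ypar_bounds(1)[OF this(1)] ypar_bounds(2)[OF this]
    have g: "0 \<le> gbd \<kappa> (ypar r)" using gbd_bounds[of \<kappa> "ypar r"] y \<kappa> by auto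
    show "ennreal (?h (ypar r)) + of_nat (Suc f) * ennreal (ypar r ^ f * gbd \<kappa> (ypar r))
        = of_nat (Suc (Suc f)) * ennreal (ypar r ^ Suc f)"
      unfolding ennreal_of_nat_eq_real_of_nat
      using y g h[OF y]
      by (simp add: ennreal_mult[symmetric] ennreal_plus[symmetric] del: ennreal_plus of_nat_Suc power_Suc)
         (simp add: algebra_simps)
  qed
  also have "\<dots> = of_nat (Suc (Suc f)) * level_int \<kappa> (\<lambda>r. ennreal (ypar r ^ Suc f)) \<rho>"
    by (rule level_int_cmult) measurable
  finally show ?thesis .
qed

text \<open>For \<open>z\<close> at least 2 the power is at most \<open>y\<close> squared, so the
  worst law with a given mass at 1 puts the rest at 2. This is why only \<kappa> enters the
  bounds.\<close>

lemma nn_integral_pow_le: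
  fixes y :: real
  assumes "pmf Z 0 = 0" "0 \<le> y" "y \<le> 1"
  shows "(\<integral>\<^sup>+z. ennreal (y ^ z) \<partial>measure_pmf Z) \<le> ennreal (y - (1 - pmf Z 1) * y * (1 - y))"
proof -
  have nz: "AE z in measure_pmf Z. z \<noteq> 0"
    using assms(1) unfolding AE_measure_pmf_iff set_pmf_eq by (metis mem_Collect_eq)
  have "(\<integral>\<^sup>+z. ennreal (y ^ z) \<partial>measure_pmf Z)
      \<le> (\<integral>\<^sup>+z. ennreal (y\<^sup>2) + ennreal (y * (1 - y)) * indicator {1} z \<partial>measure_pmf Z)"
  proof (rule nn_integral_mono_AE, use nz in eventually_elim)
    fix z :: nat assume z: "z \<noteq> 0"
    show "ennreal (y ^ z) \<le> ennreal (y\<^sup>2) + ennreal (y * (1 - y)) * indicator {1} z"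
    proof (cases "z = 1")
      case True
      have "ennreal (y\<^sup>2) + ennreal (y * (1 - y)) = ennreal (y\<^sup>2 + y * (1 - y))"
        using assms by (intro ennreal_plus[symmetric]) auto
      also have "y\<^sup>2 + y * (1 - y) = y" by (simp add: power2_eq_square algebra_simps)
      finally show ?thesis using True by simp
    next
      case False
      then have "y ^ z \<le> y\<^sup>2" using z assms by (intro power_decreasing) auto
      then show ?thesis using False by (simp add: ennreal_leI)
    qed
  qed
  also have "\<dots> = ennreal (y\<^sup>2) + ennreal (y * (1 - y)) * ennreal (pmf Z 1)"
    by (subst nn_integral_add) (auto simp: nn_integral_cmult_indicator emeasure_pmf_single)
  also have "\<dots> = ennreal (y\<^sup>2 + y * (1 - y) * pmf Z 1)"
    using assms by (simp add: ennreal_mult[symmetric] ennreal_plus[symmetric] del: ennreal_plus)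
  also have "y\<^sup>2 + y * (1 - y) * pmf Z 1 = y - (1 - pmf Z 1) * y * (1 - y)"
    by (simp add: power2_eq_square algebra_simps)
  finally show ?thesis .
qed

text \<open>The supersolution property of \<open>gbd\<close>: its associated integrand
  \<open>?h\<close> dominates the generating function of \<open>Z\<close>, and
  \<open>level_int_FTC\<close> integrates \<open>?h\<close> exactly.\<close>

lemma ret_bound_fresh:
  assumes \<rho>: "0 \<le> \<rho>" "\<rho> \<le> 1" and Z: "pmf Z 0 = 0" "pmf Z 1 < 1" and \<kappa>: "\<kappa> = 1 - pmf Z 1"
  shows "(\<integral>\<^sup>+z. ret_bound \<kappa> [z] \<rho> \<partial>measure_pmf Z) \<le> ennreal (gbd \<kappa> (ypar \<rho>))"
proof -
  have k: "0 < \<kappa>" "\<kappa> \<le> 1" using Z \<kappa> by (auto simp: pmf_nonneg)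
  let ?h = "\<lambda>y. gbd \<kappa> y + (1 - \<kappa> * (1 - y)) * (y - gbd \<kappa> y)"
  \<comment> \<open>The difference of the two sides is \<kappa> y (1 - y) (1 - \<kappa> (1 - y/2)),
    which is nonnegative because \<kappa> \<le> 1.\<close>
  have h: "y - \<kappa> * y * (1 - y) \<le> ?h y" if "0 \<le> y" "y \<le> 1" for y
  proof -
    have "?h y = y - \<kappa>*(1-y)*\<kappa>*y*(1-y/2)" unfolding gbd_def by (simp add: field_simps)
    moreover have "(\<kappa>*y*(1-y))*(\<kappa>*(1-y/2)) \<le> (\<kappa>*y*(1-y))*1"
      using that k by (intro mult_left_mono mult_le_one) auto
    ultimately show ?thesis by (simp add: algebra_simps)
  qed
  have nn: "0 \<le> y - \<kappa> * y * (1 - y)" if "0 \<le> y" "y \<le> 1" for y :: real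
  proof -
    have "\<kappa> * (y * (1 - y)) \<le> 1 * (y * 1)" using that k by (intro mult_mono) auto
    then show ?thesis by (simp add: mult.assoc)
  qed
  have "(\<integral>\<^sup>+z. ret_bound \<kappa> [z] \<rho> \<partial>measure_pmf Z)
      = level_int \<kappa> (\<lambda>r. \<integral>\<^sup>+z. ennreal (ypar r ^ z) \<partial>measure_pmf Z) \<rho>"
    by (simp add: level_int_nn_integral)
  also have "\<dots> \<le> level_int \<kappa> (\<lambda>r. ennreal (?h (ypar r))) \<rho>"
  proof (rule level_int_mono[OF \<rho> k(1)])
    fix r :: real assume "0 \<le> r" "r \<le> 1"
    note y = ypar_bounds(1)[OF this(1)] ypar_bounds(2)[OF this]
    show "(\<integral>\<^sup>+z. ennreal (ypar r ^ z) \<partial>measure_pmf Z) \<le> ennreal (?h (ypar r))"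
      using nn_integral_pow_le[OF Z(1) y] h[OF y] unfolding \<kappa>
      by (meson ennreal_leI order_trans)
  qed
  also have "\<dots> = ennreal (gbd \<kappa> (ypar \<rho>))"
  proof (rule level_int_FTC[OF \<rho> k(1)])
    fix y :: real
    show "(gbd \<kappa> has_real_derivative 1 - \<kappa> * (1 - y)) (at y)"
      unfolding gbd_def by (auto intro!: derivative_eq_intros simp: field_simps)
    show "0 \<le> ?h y" if "0 \<le> y" "y \<le> 1"
      using nn[OF that] h[OF that] by linarith
  qed
  finally show ?thesis .
qed

text \<open>After the merge the edges of both blocks run under the same clocks, so their weights
  multiply and the exponents add.\<close>

lemma merge_bound_snoc: "merge_bound \<kappa> (gs @ [f']) f \<rho> = ret_bound \<kappa> (gs @ [f' + f]) \<rho>"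
  if "0 \<le> \<rho>" "\<rho> \<le> 1" "0 < \<kappa>"
  using that
proof (induction gs arbitrary: \<rho>)
  case Nil
  then show ?case
    by (simp, intro level_int_cong) (auto simp: power_add ennreal_mult ypar_bounds)
next
  case (Cons g gs)
  then show ?case by (simp, intro level_int_cong) auto
qed

text \<open>Superharmonicity for a tip with \<open>f\<close> unexplored edges and one back edge,
  multiplied by the number of choices to avoid division. The induction peels off the bottom block:
  its clock is an outer integral that commutes with a step at the top. This is why \<rho> must be
  general, although only \<rho> = 1 is used in the end.\<close>

lemma ret_bound_step:
  assumes \<rho>: "0 \<le> \<rho>" "\<rho> \<le> 1" and Z: "pmf Z 0 = 0" "pmf Z 1 < 1" and \<kappa>: "\<kappa> = 1 - pmf Z 1"
  shows "merge_bound \<kappa> gs f \<rho> + of_nat f * (\<integral>\<^sup>+z. ret_bound \<kappa> (gs @ [f - 1, z]) \<rho> \<partial>measure_pmf Z)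
     \<le> of_nat (Suc f) * ret_bound \<kappa> (gs @ [f]) \<rho>"
  using \<rho>
proof (induction gs arbitrary: \<rho>)
  case Nil
  have k: "0 < \<kappa>" "\<kappa> \<le> 1" using Z \<kappa> by (auto simp: pmf_nonneg)
  show ?case
  proof (cases f)
    case 0
    then show ?thesis by (simp add: level_int_one)
  next
    case (Suc n)
    have "(\<integral>\<^sup>+z. ret_bound \<kappa> ([f - 1, z]) \<rho> \<partial>measure_pmf Z)
       = level_int \<kappa> (\<lambda>r. \<integral>\<^sup>+z. ennreal (ypar r ^ n) * ret_bound \<kappa> [z] r \<partial>measure_pmf Z) \<rho>"
      unfolding Suc by (simp add: level_int_nn_integral)
    also have "\<dots> \<le> level_int \<kappa> (\<lambda>r. ennreal (ypar r ^ n * gbd \<kappa> (ypar r))) \<rho>"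
    proof (rule level_int_mono[OF Nil k(1)])
      fix r :: real assume r: "0 \<le> r" "r \<le> 1"
      note y = ypar_bounds(1)[OF r(1)] ypar_bounds(2)[OF r]
      show "(\<integral>\<^sup>+z. ennreal (ypar r ^ n) * ret_bound \<kappa> [z] r \<partial>measure_pmf Z)
           \<le> ennreal (ypar r ^ n * gbd \<kappa> (ypar r))"
        using y ret_bound_fresh[OF r Z \<kappa>] gbd_bounds[of \<kappa> "ypar r"] k
        by (simp add: nn_integral_cmult ennreal_mult mult_left_mono)
    qed
    finally have "merge_bound \<kappa> [] f \<rho> + of_nat f * (\<integral>\<^sup>+z. ret_bound \<kappa> ([f - 1, z]) \<rho> \<partial>measure_pmf Z)
      \<le> ennreal (ypar \<rho> ^ Suc n)
       + of_nat (Suc n) * level_int \<kappa> (\<lambda>r. ennreal (ypar r ^ n * gbd \<kappa> (ypar r))) \<rho>"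
      unfolding Suc merge_bound.simps by (intro add_left_mono mult_left_mono) auto
    also have "\<dots> = of_nat (Suc f) * ret_bound \<kappa> [f] \<rho>"
      unfolding level_int_power[OF Nil k] Suc by simp
    finally show ?thesis by simp
  qed
next
  case (Cons g gs)
  have k: "0 < \<kappa>" using Z \<kappa> by auto
  let ?I = "\<lambda>r. \<integral>\<^sup>+z. ret_bound \<kappa> (gs @ [f - 1, z]) r \<partial>measure_pmf Z"
  have [measurable]: "?I \<in> borel_measurable borel"
    unfolding nn_integral_measure_pmf nn_integral_count_space_nat by measurable
  have "merge_bound \<kappa> (g # gs) f \<rho> + of_nat f * (\<integral>\<^sup>+z. ret_bound \<kappa> ((g # gs) @ [f - 1, z]) \<rho> \<partial>measure_pmf Z)
     = level_int \<kappa> (\<lambda>r. ennreal (ypar r ^ g) * merge_bound \<kappa> gs f r + of_nat f * (ennreal (ypar r ^ g) * ?I r)) \<rho>"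
    by (simp add: level_int_nn_integral level_int_add level_int_cmult nn_integral_cmult)
  also have "\<dots> \<le> level_int \<kappa> (\<lambda>r. of_nat (Suc f) * (ennreal (ypar r ^ g) * ret_bound \<kappa> (gs @ [f]) r)) \<rho>"
  proof (rule level_int_mono[OF Cons.prems k])
    fix r :: real assume r: "0 \<le> r" "r \<le> 1"
    show "ennreal (ypar r ^ g) * merge_bound \<kappa> gs f r + of_nat f * (ennreal (ypar r ^ g) * ?I r)
      \<le> of_nat (Suc f) * (ennreal (ypar r ^ g) * ret_bound \<kappa> (gs @ [f]) r)"
      using mult_left_mono[OF Cons.IH[OF r], of "ennreal (ypar r ^ g)"]
      by (simp add: distrib_left mult.left_commute del: of_nat_Suc)
  qed
  also have "\<dots> = of_nat (Suc f) * ret_bound \<kappa> ((g # gs) @ [f]) \<rho>"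
    by (simp add: level_int_cmult del: of_nat_Suc)
  finally show ?case .
qed

lemma ret_bound_le_1:
  assumes "0 \<le> \<rho>" "\<rho> \<le> 1" "0 < \<kappa>"
  shows "ret_bound \<kappa> fs \<rho> \<le> 1"
  using assms
proof (induction fs arbitrary: \<rho>)
  case (Cons f fs)
  have "ret_bound \<kappa> (f # fs) \<rho> \<le> level_int \<kappa> (\<lambda>r. 1) \<rho>"
    unfolding ret_bound.simps
  proof (rule level_int_mono[OF Cons.prems])
    fix r :: real assume r: "0 \<le> r" "r \<le> 1"
    have "ennreal (ypar r ^ f) \<le> 1" using r by (auto intro!: power_le_one ypar_bounds)
    then show "ennreal (ypar r ^ f) * ret_bound \<kappa> fs r \<le> 1"
      using Cons.IH[OF r Cons.prems(3)] mult_mono[of "ennreal (ypar r ^ f)" 1 "ret_bound \<kappa> fs r" 1] by auto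
  qed
  then show ?case by (simp add: level_int_one)
qed auto

section \<open>The Lyapunov function on stacks\<close>

text \<open>\<open>stack_core\<close> only sees the blocks above level \<open>k\<close>. The extra \<open>1\<close> pays for a visit to level \<open>k\<close>
  with a dead-end tip, which occurs only when the walk has climbed to a root with a single child. The
  parameter \<open>r\<close> of \<open>stack_pot\<close> counts the unexplored ancestors of the start: each of them carries
  enough potential to absorb any change of the stack when it is reached.\<close>

definition stack_core :: "real \<Rightarrow> nat \<Rightarrow> nat list \<Rightarrow> ennreal" where
  "stack_core \<kappa> k fs = ennreal (4 / \<kappa>) * ret_bound \<kappa> (drop (Suc k) fs) 1
     + (if k < length fs \<and> last fs = 0 then 1 else 0)"

definition stack_pot :: "real \<Rightarrow> nat \<Rightarrow> nat list \<Rightarrow> nat \<Rightarrow> ennreal" where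
  "stack_pot \<kappa> k fs r = stack_core \<kappa> k fs + (ennreal (4 / \<kappa>) + 1) * of_nat r"

lemma stack_core_le:
  assumes "0 < \<kappa>"
  shows "stack_core \<kappa> k fs \<le> ennreal (4 / \<kappa>) + 1"
proof -
  have "ennreal (4 / \<kappa>) * ret_bound \<kappa> (drop (Suc k) fs) 1 \<le> ennreal (4 / \<kappa>) * 1"
    using assms by (intro mult_left_mono ret_bound_le_1) auto
  then show ?thesis unfolding stack_core_def by (intro add_mono) auto
qed

lemma stack_pot_le:
  assumes "0 < \<kappa>"
  shows "stack_pot \<kappa> k fs r \<le> (ennreal (4 / \<kappa>) + 1) * of_nat (Suc r)"
  using stack_core_le[OF assms, of k fs] unfolding stack_pot_def
  by (simp add: distrib_left)

lemma stack_pot_up: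
  assumes "0 < \<kappa>"
  shows "stack_pot \<kappa> k fs' r \<le> stack_pot \<kappa> k fs (Suc r)"
  using stack_pot_le[OF assms, of k fs' r] unfolding stack_pot_def[of \<kappa> k fs "Suc r"]
  by (meson add_increasing order_trans zero_le)

text \<open>A freshly revealed vertex has a child almost surely, so the dead-end term vanishes after
  a push.\<close>

lemma stack_core_push:
  assumes Z: "pmf Z 0 = 0"
  shows "(\<integral>\<^sup>+z. stack_core \<kappa> k (gs @ [f, z]) \<partial>measure_pmf Z)
       = ennreal (4 / \<kappa>) * (\<integral>\<^sup>+z. ret_bound \<kappa> (drop (Suc k) (gs @ [f, z])) 1 \<partial>measure_pmf Z)"
proof -
  have nz: "AE z in measure_pmf Z. z \<noteq> 0"
    using Z unfolding AE_measure_pmf_iff set_pmf_eq by (metis mem_Collect_eq)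
  have "(\<integral>\<^sup>+z. stack_core \<kappa> k (gs @ [f, z]) \<partial>measure_pmf Z)
       = (\<integral>\<^sup>+z. ennreal (4 / \<kappa>) * ret_bound \<kappa> (drop (Suc k) (gs @ [f, z])) 1 \<partial>measure_pmf Z)"
    by (rule nn_integral_cong_AE, use nz in eventually_elim) (simp add: stack_core_def)
  then show ?thesis by (simp add: nn_integral_cmult)
qed

text \<open>A fresh block above level \<open>k\<close> returns with weight at most
  \<open>gbd \<kappa> 1\<close>, which is 1 - \<kappa>/2. The factor 4/\<kappa> is chosen to turn
  the missing \<kappa>/2 into a potential drop of 2.\<close>

lemma stack_core_at_level:
  assumes Z: "pmf Z 0 = 0" "pmf Z 1 < 1" and \<kappa>: "\<kappa> = 1 - pmf Z 1" and len: "length gs = k"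
  shows "(\<integral>\<^sup>+z. stack_core \<kappa> k (gs @ [f, z]) \<partial>measure_pmf Z) + 2 \<le> ennreal (4 / \<kappa>)"
proof -
  have k: "0 < \<kappa>" "\<kappa> \<le> 1" using Z \<kappa> by (auto simp: pmf_nonneg)
  have "(\<integral>\<^sup>+z. stack_core \<kappa> k (gs @ [f, z]) \<partial>measure_pmf Z)
      = ennreal (4 / \<kappa>) * (\<integral>\<^sup>+z. ret_bound \<kappa> [z] 1 \<partial>measure_pmf Z)"
    unfolding stack_core_push[OF Z(1)] using len by simp
  also have "\<dots> \<le> ennreal (4 / \<kappa>) * ennreal (gbd \<kappa> (ypar 1))"
    by (intro mult_left_mono ret_bound_fresh Z \<kappa>) auto
  also have "\<dots> = ennreal (4 / \<kappa> * gbd \<kappa> 1)"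
    using k gbd_bounds(1)[of \<kappa> 1] unfolding ypar_1 by (intro ennreal_mult[symmetric]) auto
  also have "4 / \<kappa> * gbd \<kappa> 1 = 4 / \<kappa> - 2" using k by (simp add: gbd_def field_simps)
  finally have "(\<integral>\<^sup>+z. stack_core \<kappa> k (gs @ [f, z]) \<partial>measure_pmf Z) + 2 \<le> ennreal (4 / \<kappa> - 2) + 2"
    by (rule add_right_mono)
  also have "\<dots> = ennreal (4 / \<kappa> - 2) + ennreal 2" by simp
  also have "\<dots> = ennreal (4 / \<kappa>)"
  proof -
    have "2 \<le> 4 / \<kappa>" using k by (simp add: field_simps)
    then show ?thesis by (subst ennreal_plus[symmetric]) auto
  qed
  finally show ?thesis .
qed

text \<open>The drift inequality: each visit to path length \<open>k\<close> costs 1, and the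
  potential has to pay for it. Above the level it follows from \<open>ret_bound_step\<close>, below
  it the potential is constant, and at the level the drop of 2 on a push pays.\<close>

lemma stack_core_merge_step:
  assumes Z: "pmf Z 0 = 0" "pmf Z 1 < 1" and \<kappa>: "\<kappa> = 1 - pmf Z 1"
    and gs: "gs = hs @ [f']"
  shows "of_nat (Suc f) * (if length gs = k then 1 else 0) + stack_core \<kappa> k (hs @ [f' + f])
      + of_nat f * (\<integral>\<^sup>+z. stack_core \<kappa> k (gs @ [f - 1, z]) \<partial>measure_pmf Z)
     \<le> of_nat (Suc f) * stack_core \<kappa> k (gs @ [f])"
proof -
  have kp: "0 < \<kappa>" "\<kappa> \<le> 1" using Z \<kappa> by (auto simp: pmf_nonneg)
  let ?C = "ennreal (4 / \<kappa>)"
  consider "k < length gs" | "length gs < k" | "length gs = k" by linarith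
  then show ?thesis
  proof cases
    case 1
    define us where "us = drop (Suc k) gs"
    have merged: "ret_bound \<kappa> (drop (Suc k) (hs @ [f' + f])) 1 = merge_bound \<kappa> us f 1"
    proof (cases "length hs = k")
      case True then show ?thesis by (simp add: us_def gs)
    next
      case False
      then have "us = drop (Suc k) hs @ [f']" "drop (Suc k) (hs @ [f' + f]) = drop (Suc k) hs @ [f' + f]"
        using 1 by (auto simp: us_def gs)
      then show ?thesis using kp by (simp add: merge_bound_snoc)
    qed
    \<comment> \<open>A merged tip is a dead end only if \<open>f = 0\<close>, and then the dead-end
      term was already present before the merge.\<close>
    have zero: "(if k < length (hs @ [f' + f]) \<and> last (hs @ [f' + f]) = 0 then 1 else 0)
      \<le> (of_nat (Suc f) * (if k < length (gs @ [f]) \<and> last (gs @ [f]) = 0 then 1 else 0) :: ennreal)"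
      using 1 by (auto simp: gs)
    have "?C * (merge_bound \<kappa> us f 1 + of_nat f * (\<integral>\<^sup>+z. ret_bound \<kappa> (us @ [f - 1, z]) 1 \<partial>measure_pmf Z))
      \<le> ?C * (of_nat (Suc f) * ret_bound \<kappa> (us @ [f]) 1)"
      by (intro mult_left_mono ret_bound_step Z \<kappa>) auto
    from add_mono[OF this zero] show ?thesis
      using 1 unfolding stack_core_push[OF Z(1)] unfolding stack_core_def merged
      by (simp add: us_def[symmetric] distrib_left distrib_right mult_ac add_ac del: of_nat_Suc)
  next
    \<comment> \<open>Even after a push no block lies above level \<open>k\<close>, so every core
      involved is 4/\<kappa> almost surely.\<close>
    case 2
    then show ?thesis unfolding stack_core_push[OF Z(1)] unfolding stack_core_def
      by (simp add: gs distrib_right)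
  next
    case 3
    have m: "stack_core \<kappa> k (hs @ [f' + f]) = ?C" using 3 by (simp add: stack_core_def gs)
    have s: "stack_core \<kappa> k (gs @ [f]) = ?C + (if f = 0 then 1 else 0)"
      using 3 by (simp add: stack_core_def)
    show ?thesis
    proof (cases f)
      \<comment> \<open>The only move is the back edge; the dead-end term pays for the
        visit.\<close>
      case 0
      then show ?thesis unfolding m s using 3 by (simp add: add.commute)
    next
      case (Suc n)
      let ?I = "\<integral>\<^sup>+z. stack_core \<kappa> k (gs @ [f - 1, z]) \<partial>measure_pmf Z"
      \<comment> \<open>With \<open>f\<close> positive, \<open>Suc f\<close> is at most
        \<open>2 * f\<close>: a drop of 2 on each of the \<open>f\<close> fresh edges covers the
        visit for all \<open>Suc f\<close> choices.\<close>
      have "of_nat (Suc f) + ?C + of_nat f * ?I \<le> of_nat f * 2 + ?C + of_nat f * ?I"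
        by (intro add_mono order_refl) (simp add: Suc mult_2_right)
      also have "\<dots> = ?C + of_nat f * (?I + 2)" by (simp add: distrib_left add_ac)
      also have "\<dots> \<le> ?C + of_nat f * ?C"
        by (intro add_mono mult_left_mono stack_core_at_level[OF Z \<kappa> 3]) auto
      finally show ?thesis unfolding m s using 3 Suc by (simp add: distrib_right)
    qed
  qed
qed

text \<open>With an empty path there is no back edge, so every move is a push.\<close>

lemma stack_core_base_step:
  assumes Z: "pmf Z 0 = 0" "pmf Z 1 < 1" and \<kappa>: "\<kappa> = 1 - pmf Z 1" and f: "0 < f"
  shows "(if k = 0 then 1 else 0) + (\<integral>\<^sup>+z. stack_core \<kappa> k [f - 1, z] \<partial>measure_pmf Z)
     \<le> stack_core \<kappa> k [f]"
proof (cases "k = 0")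
  case True
  have "1 + (\<integral>\<^sup>+z. stack_core \<kappa> k [f - 1, z] \<partial>measure_pmf Z)
     \<le> (\<integral>\<^sup>+z. stack_core \<kappa> k ([] @ [f - 1, z]) \<partial>measure_pmf Z) + 2"
    by (subst add.commute) (intro add_mono, auto)
  also have "\<dots> \<le> ennreal (4 / \<kappa>)"
    by (rule stack_core_at_level[OF Z \<kappa>]) (simp add: True)
  finally show ?thesis using True f by (simp add: stack_core_def)
next
  case False
  then show ?thesis
    using stack_core_push[OF Z(1), of \<kappa> k "[]" "f - 1"] f by (simp add: stack_core_def drop_Suc split: nat.splits)
qed

lemma stack_pot_merge_step:
  assumes Z: "pmf Z 0 = 0" "pmf Z 1 < 1" and \<kappa>: "\<kappa> = 1 - pmf Z 1"
    and gs: "gs = hs @ [f']"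
  shows "of_nat (Suc f) * (if length gs = k then 1 else 0) + stack_pot \<kappa> k (hs @ [f' + f]) r
      + of_nat f * (\<integral>\<^sup>+z. stack_pot \<kappa> k (gs @ [f - 1, z]) r \<partial>measure_pmf Z)
     \<le> of_nat (Suc f) * stack_pot \<kappa> k (gs @ [f]) r"
proof -
  let ?R = "(ennreal (4 / \<kappa>) + 1) * of_nat r"
  have "of_nat (Suc f) * (if length gs = k then 1 else 0) + stack_pot \<kappa> k (hs @ [f' + f]) r
      + of_nat f * (\<integral>\<^sup>+z. stack_pot \<kappa> k (gs @ [f - 1, z]) r \<partial>measure_pmf Z)
     = (of_nat (Suc f) * (if length gs = k then 1 else 0) + stack_core \<kappa> k (hs @ [f' + f])
      + of_nat f * (\<integral>\<^sup>+z. stack_core \<kappa> k (gs @ [f - 1, z]) \<partial>measure_pmf Z)) + of_nat (Suc f) * ?R"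
    unfolding stack_pot_def by (simp add: nn_integral_add distrib_left distrib_right add_ac)
  also have "\<dots> \<le> of_nat (Suc f) * stack_core \<kappa> k (gs @ [f]) + of_nat (Suc f) * ?R"
    by (intro add_right_mono stack_core_merge_step assms)
  also have "\<dots> = of_nat (Suc f) * stack_pot \<kappa> k (gs @ [f]) r"
    unfolding stack_pot_def by (simp add: distrib_left del: of_nat_Suc)
  finally show ?thesis .
qed

lemma stack_pot_base_step:
  assumes Z: "pmf Z 0 = 0" "pmf Z 1 < 1" and \<kappa>: "\<kappa> = 1 - pmf Z 1" and f: "0 < f"
  shows "(if k = 0 then 1 else 0) + (\<integral>\<^sup>+z. stack_pot \<kappa> k [f - 1, z] r \<partial>measure_pmf Z)
     \<le> stack_pot \<kappa> k [f] r"
  using add_right_mono[OF stack_core_base_step[OF assms, of k], of "(ennreal (4 / \<kappa>) + 1) * of_nat r"]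
  unfolding stack_pot_def by (simp add: nn_integral_add add_ac)

section \<open>Contraction of paths in a tree\<close>

abbreviation blocks :: "'v \<Rightarrow> ('v \<Rightarrow> 'v set) \<times> ('v \<times> 'v) list \<Rightarrow> 'v set list" where
  "blocks x st \<equiv> path_blocks (fst st) x (snd st)"

text \<open>Here \<open>D\<close> stands for the set of all explored vertices, so these are the
  unexplored edges of the block \<open>B\<close>.\<close>

definition fresh :: "('v \<Rightarrow> 'v \<Rightarrow> bool) \<Rightarrow> 'v set \<Rightarrow> 'v set \<Rightarrow> ('v \<times> 'v) set" where
  "fresh E D B = {(u, w). u \<in> B \<and> E u w \<and> w \<notin> D}"

definition across :: "('v \<Rightarrow> 'v \<Rightarrow> bool) \<Rightarrow> 'v set \<Rightarrow> 'v set \<Rightarrow> ('v \<times> 'v) set" where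
  "across E B A = {(u, w). u \<in> B \<and> E u w \<and> w \<in> A}"

text \<open>The list starts at the tip. A single edge into all lower blocks together, ending in the
  next one, is what acyclicity leaves of the tree after contractions.\<close>

fun linked :: "('v \<Rightarrow> 'v \<Rightarrow> bool) \<Rightarrow> 'v set list \<Rightarrow> bool" where
  "linked E (B # B' # bs) \<longleftrightarrow>
     (\<exists>e. across E B (\<Union> (set (B' # bs))) = {e} \<and> snd e \<in> B') \<and> linked E (B' # bs)"
| "linked E _ \<longleftrightarrow> True"

text \<open>The deterministic effect of a chosen edge, split off from the random choice so that
  expectations become sums over edges.\<close>

definition lcrw_move :: "'v \<Rightarrow> ('v \<Rightarrow> 'v set) \<times> ('v \<times> 'v) list \<Rightarrow> 'v \<times> 'v
      \<Rightarrow> ('v \<Rightarrow> 'v set) \<times> ('v \<times> 'v) list" where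
  "lcrw_move x st e =
     (if fst st (snd e) \<in> set (blocks x st) then
        (let j = (LEAST j. j < length (blocks x st) \<and> blocks x st ! j = fst st (snd e));
             C = \<Union> (set (drop j (blocks x st))) in
         ((\<lambda>v. if v \<in> C then C else fst st v), take j (snd st)))
      else (fst st, snd st @ [e]))"

lemma lcrw_step_move:
  "lcrw_step E x st u =
     (let S = outs E (last (blocks x st)) in
      if S = {} \<or> infinite S then st else lcrw_move x st (pick S u))"
  by (simp add: lcrw_step_def lcrw_move_def Let_def)

text \<open>The set \<open>D\<close> of explored vertices never shrinks: a truncated piece of the
  path survives inside the contracted tip, so the blocks on the path always partition
  \<open>D\<close>.\<close>

definition lcrw_inv :: "('v \<Rightarrow> 'v \<Rightarrow> bool) \<Rightarrow> 'v \<Rightarrow> 'v set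
      \<Rightarrow> ('v \<Rightarrow> 'v set) \<times> ('v \<times> 'v) list \<Rightarrow> bool" where
  "lcrw_inv E x D st \<longleftrightarrow>
     (\<forall>v w. w \<in> fst st v \<longleftrightarrow> fst st w = fst st v) \<and>
     \<Union> (set (blocks x st)) = D \<and> distinct (blocks x st) \<and>
     (\<forall>v. v \<notin> D \<longrightarrow> fst st v = {v}) \<and> linked E (rev (blocks x st))"

lemma length_blocks [simp]: "length (blocks x st) = Suc (length (snd st))"
  by (simp add: path_blocks_def)

lemma blocks_snocE:
  obtains hs B where "blocks x st = hs @ [B]"
  by (metis length_blocks length_0_conv nat.distinct(1) rev_exhaust)

lemma linked_cong:
  assumes "\<And>v. v \<in> \<Union> (set bs) \<Longrightarrow> E v = E' v"
  shows "linked E bs = linked E' bs"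
  using assms
proof (induction E bs rule: linked.induct)
  case (1 E B B' bs)
  have "across E B (\<Union> (set (B' # bs))) = across E' B (\<Union> (set (B' # bs)))"
    using 1(2) by (auto simp: across_def)
  then show ?case using 1 by simp
qed auto

lemma lcrw_inv_cong:
  assumes "lcrw_inv E x D st" "\<And>v. v \<in> D \<Longrightarrow> E v = E' v"
  shows "lcrw_inv E' x D st"
  using assms linked_cong[of "rev (blocks x st)" E E'] by (auto simp: lcrw_inv_def)

lemma lcrw_inv_init: "lcrw_inv E x {x} (\<lambda>v. {v}, [])"
  by (auto simp: lcrw_inv_def path_blocks_def)

lemma lcrw_inv_block:
  assumes "lcrw_inv E x D st" "B \<in> set (blocks x st)" "v \<in> B"
  shows "fst st v = B"
proof -
  have "\<exists>w. B = fst st w" using assms(2) by (auto simp: path_blocks_def)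
  then show ?thesis using assms by (auto simp: lcrw_inv_def)
qed

lemma lcrw_inv_disjoint:
  assumes "lcrw_inv E x D st" "blocks x st = hs @ [B]"
  shows "B \<inter> \<Union> (set hs) = {}"
proof (rule ccontr)
  assume "\<not> ?thesis"
  then obtain v A where v: "v \<in> B" "v \<in> A" "A \<in> set hs" by auto
  then have "fst st v = B" "fst st v = A"
    using lcrw_inv_block[OF assms(1)] by (auto simp: assms(2))
  then show False using v assms by (auto simp: lcrw_inv_def)
qed

text \<open>Distinct blocks of the path are disjoint and cover \<open>D\<close>, so an edge out of
  the tip either ends in a lower block or leaves \<open>D\<close>.\<close>

lemma outs_eq:
  assumes "lcrw_inv E x D st" "blocks x st = hs @ [B]"
  shows "outs E B = fresh E D B \<union> across E B (\<Union> (set hs))"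
    and "fresh E D B \<inter> across E B (\<Union> (set hs)) = {}"
proof -
  have D: "D = B \<union> \<Union> (set hs)" using assms by (auto simp: lcrw_inv_def)
  show "outs E B = fresh E D B \<union> across E B (\<Union> (set hs))"
    using lcrw_inv_disjoint[OF assms] unfolding outs_def fresh_def across_def D by auto
  show "fresh E D B \<inter> across E B (\<Union> (set hs)) = {}"
    unfolding fresh_def across_def D by auto
qed

lemma lcrw_move_fresh:
  assumes "lcrw_inv E x D st" "w \<notin> D"
  shows "lcrw_move x st (u, w) = (fst st, snd st @ [(u, w)])"
    and "blocks x (lcrw_move x st (u, w)) = blocks x st @ [{w}]"
proof -
  have c: "fst st w = {w}" using assms by (auto simp: lcrw_inv_def)
  then have "fst st w \<notin> set (blocks x st)" using assms by (auto simp: lcrw_inv_def)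
  then show "lcrw_move x st (u, w) = (fst st, snd st @ [(u, w)])"
    by (simp add: lcrw_move_def)
  then show "blocks x (lcrw_move x st (u, w)) = blocks x st @ [{w}]"
    by (simp add: path_blocks_def c)
qed

text \<open>That \<open>w\<close> meets \<open>D\<close> only in \<open>u\<close> is where
  acyclicity enters: the new block has exactly one edge down, and it ends in the old tip.\<close>

lemma lcrw_inv_fresh:
  assumes inv: "lcrw_inv E x D st" and b: "blocks x st = hs @ [B]"
    and w: "w \<notin> D" "u \<in> B" "\<And>v. v \<in> D \<Longrightarrow> E w v \<longleftrightarrow> v = u"
  shows "lcrw_inv E x (insert w D) (lcrw_move x st (u, w))"
proof -
  note m = lcrw_move_fresh[OF inv w(1), of u]
  have D: "D = B \<union> \<Union> (set hs)" using inv b by (auto simp: lcrw_inv_def)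
  have "across E {w} (\<Union> (set (B # rev hs))) = {(w, u)}"
    using w unfolding across_def D by auto
  then have "linked E (rev (blocks x st @ [{w}]))"
    using inv w(2) by (simp add: lcrw_inv_def b)
  moreover have "{w} \<notin> set (blocks x st)" using inv w(1) by (auto simp: lcrw_inv_def)
  ultimately show ?thesis
    using inv unfolding lcrw_inv_def m(2) unfolding m(1) by auto
qed

text \<open>Lower blocks keep their counts since \<open>w\<close> is joined to \<open>D\<close> only
  through \<open>u\<close> in the tip. The count of the new block stays symbolic, because it differs
  for a child and for the parent of an explored vertex.\<close>

lemma stack_fresh:
  assumes inv: "lcrw_inv E x D st" and b: "blocks x st = hs @ [B]"
    and w: "w \<notin> D" "u \<in> B" "\<And>v. v \<in> D \<Longrightarrow> E v w \<longleftrightarrow> v = u"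
    and fin: "finite (fresh E D B)"
  shows "map (\<lambda>A. card (fresh E (insert w D) A)) (blocks x (lcrw_move x st (u, w)))
       = map (\<lambda>A. card (fresh E D A)) hs
         @ [card (fresh E D B) - 1, card (fresh E (insert w D) {w})]"
proof -
  have D: "D = B \<union> \<Union> (set hs)" using inv b by (auto simp: lcrw_inv_def)
  have "fresh E (insert w D) A = fresh E D A" if "A \<in> set hs" for A
    using w(2,3) that lcrw_inv_disjoint[OF inv b] unfolding fresh_def D by auto
  moreover have "fresh E (insert w D) B = fresh E D B - {(u, w)}"
    using w unfolding fresh_def D by auto
  moreover have "(u, w) \<in> fresh E D B"
    using w unfolding fresh_def D by auto
  ultimately show ?thesis
    unfolding lcrw_move_fresh(2)[OF inv w(1)] b using fin by simp
qed

text \<open>The only downward edge of \<open>B\<close> ends in \<open>B'\<close>, so the merged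
  block inherits exactly the downward edge of \<open>B'\<close>, and linkage persists.\<close>

lemma lcrw_move_back:
  assumes inv: "lcrw_inv E x D st" and b: "blocks x st = hs @ [B', B]" and w: "w \<in> B'"
  shows "blocks x (lcrw_move x st (u, w)) = hs @ [B' \<union> B]"
    and "lcrw_inv E x D (lcrw_move x st (u, w))"
proof -
  define cls p where "cls = fst st" and "p = snd st"
  have st: "st = (cls, p)" by (simp add: cls_def p_def)
  define C where "C = B' \<union> B"
  define cls' where "cls' v = (if v \<in> C then C else cls v)" for v
  have P: "w \<in> cls v \<longleftrightarrow> cls w = cls v" for v w using inv by (simp add: lcrw_inv_def st)
  have dist: "distinct (hs @ [B', B])" using inv by (simp add: lcrw_inv_def b[symmetric])
  have blk: "cls v = A" if "A \<in> set (hs @ [B', B])" "v \<in> A" for v A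
    using lcrw_inv_block[OF inv, of A v] that unfolding b by (simp add: st)
  have Cmem: "v \<in> C \<longleftrightarrow> cls v = B' \<or> cls v = B" for v
  proof
    show "v \<in> C \<Longrightarrow> cls v = B' \<or> cls v = B" using blk[of B' v] blk[of B v] by (auto simp: C_def)
    show "cls v = B' \<or> cls v = B \<Longrightarrow> v \<in> C" using P[of v v] by (auto simp: C_def)
  qed
  have cw: "cls w = B'" using blk[of B' w] w by simp
  \<comment> \<open>By distinctness \<open>B'\<close> occurs only at this index, so the cycle
    consists of the last two blocks.\<close>
  have j: "(LEAST j. j < length (hs @ [B', B]) \<and> (hs @ [B', B]) ! j = cls w) = length hs"
  proof (rule Least_equality)
    fix y assume y: "y < length (hs @ [B', B]) \<and> (hs @ [B', B]) ! y = cls w"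
    show "length hs \<le> y"
    proof (rule ccontr)
      assume "\<not> length hs \<le> y"
      then have "hs ! y = B'" "y < length hs" using y by (auto simp: nth_append cw)
      then show False using dist by auto
    qed
  qed (simp add: cw)
  have bst: "path_blocks cls x p = hs @ [B', B]" using b by (simp add: st)
  have mv: "lcrw_move x st (u, w) = (cls', take (length hs) p)"
  proof -
    have "cls w \<in> set (path_blocks cls x p)" by (simp add: bst cw)
    then show ?thesis
      unfolding lcrw_move_def st fst_conv snd_conv Let_def bst j
      by (auto simp: cls'_def C_def fun_eq_iff bst)
  qed
  have "path_blocks cls x (take (length hs) p) = take (Suc (length hs)) (path_blocks cls x p)"
    by (simp add: path_blocks_def take_map)
  also have "\<dots> = hs @ [B']" by (simp add: bst)
  finally have tk: "path_blocks cls x (take (length hs) p) = hs @ [B']" .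
  have "path_blocks cls' x (take (length hs) p)
      = map (\<lambda>A. if A = B' \<or> A = B then C else A) (path_blocks cls x (take (length hs) p))"
    by (simp add: path_blocks_def cls'_def Cmem)
  also have "\<dots> = hs @ [C]"
  proof -
    have "map (\<lambda>A. if A = B' \<or> A = B then C else A) hs = hs"
      using dist by (intro map_idI) auto
    then show ?thesis by (simp add: tk)
  qed
  finally have bl': "path_blocks cls' x (take (length hs) p) = hs @ [C]" .
  then show bl: "blocks x (lcrw_move x st (u, w)) = hs @ [B' \<union> B]"
    by (simp add: mv C_def)
  have D: "D = C \<union> \<Union> (set hs)" using inv b by (auto simp: lcrw_inv_def C_def)
  have B'ne: "B' \<noteq> {}" using w by auto
  have "C \<notin> set hs"
  proof
    assume "C \<in> set hs"
    moreover have "w \<in> C" using w by (simp add: C_def)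
    ultimately have "cls w = C" using blk[of C w] by simp
    then show False using \<open>C \<in> set hs\<close> cw dist by auto
  qed
  then have d': "distinct (hs @ [C])" using dist by simp
  have lk: "linked E (rev (hs @ [C]))"
  proof (cases hs rule: rev_cases)
    case Nil then show ?thesis by simp
  next
    case (snoc gs A)
    have L: "linked E (B # B' # A # rev gs)"
      using inv by (simp add: lcrw_inv_def b snoc)
    then obtain e where e: "across E B (\<Union> (set (B' # A # rev gs))) = {e}" "snd e \<in> B'" by auto
    have dj: "B' \<inter> \<Union> (set (A # rev gs)) = {}"
    proof (rule ccontr)
      assume "\<not> ?thesis"
      then obtain v X where "v \<in> B'" "v \<in> X" "X \<in> set hs" by (auto simp: snoc)
      then have "cls v = B'" "cls v = X" using blk by auto
      then show False using dist \<open>X \<in> set hs\<close> by auto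
    qed
    have "across E B (\<Union> (set (A # rev gs))) \<subseteq> across E B (\<Union> (set (B' # A # rev gs)))"
      by (auto simp: across_def)
    moreover have "e \<notin> across E B (\<Union> (set (A # rev gs)))"
      using e(2) dj by (auto simp: across_def)
    ultimately have "across E B (\<Union> (set (A # rev gs))) = {}" unfolding e(1) by auto
    moreover have "across E C (\<Union> (set (A # rev gs)))
       = across E B (\<Union> (set (A # rev gs))) \<union> across E B' (\<Union> (set (A # rev gs)))"
      by (auto simp: across_def C_def)
    ultimately have "across E C (\<Union> (set (A # rev gs))) = across E B' (\<Union> (set (A # rev gs)))" by simp
    then show ?thesis using L by (simp add: snoc)
  qed
  have P': "v' \<in> cls' v \<longleftrightarrow> cls' v' = cls' v" for v v'
  proof (cases "v \<in> C")
    case True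
    then show ?thesis using P[of v' v'] by (auto simp: cls'_def)
  next
    case False
    have "v' \<in> cls v \<Longrightarrow> v' \<notin> C" using False P[of v' v] by (auto simp: Cmem)
    moreover have "C \<noteq> cls v" using False P[of v v] by auto
    ultimately show ?thesis using False P[of v' v] by (auto simp: cls'_def)
  qed
  have "\<forall>v. v \<notin> D \<longrightarrow> cls' v = {v}" using inv D by (auto simp: cls'_def lcrw_inv_def st)
  then show "lcrw_inv E x D (lcrw_move x st (u, w))"
    unfolding lcrw_inv_def mv fst_conv snd_conv bl' using P' D d' lk by auto
qed

text \<open>Edges between the two merged blocks stay inside \<open>D\<close> and are not fresh, so
  the counts simply add.\<close>

lemma stack_back:
  assumes inv: "lcrw_inv E x D st" and b: "blocks x st = hs @ [B', B]" and w: "w \<in> B'"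
    and fin: "finite (fresh E D B)" "finite (fresh E D B')"
  shows "map (\<lambda>A. card (fresh E D A)) (blocks x (lcrw_move x st (u, w)))
       = map (\<lambda>A. card (fresh E D A)) hs @ [card (fresh E D B') + card (fresh E D B)]"
proof -
  have "fresh E D (B' \<union> B) = fresh E D B' \<union> fresh E D B" by (auto simp: fresh_def)
  moreover have "fresh E D B' \<inter> fresh E D B = {}"
    using lcrw_inv_disjoint[OF inv, of "hs @ [B']" B] b by (auto simp: fresh_def)
  ultimately show ?thesis
    unfolding lcrw_move_back(1)[OF inv b w] using fin by (simp add: card_Un_disjoint)
qed

section \<open>Explored subtrees of Ulam-Harris trees\<close>

definition ancestors :: "'a list \<Rightarrow> 'a list set" where
  "ancestors a = {u. \<exists>s. a = u @ s}"

lemma finite_ancestors: "finite (ancestors a)"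
proof -
  have "ancestors a \<subseteq> (\<lambda>n. take n a) ` {..length a}"
  proof
    fix u assume "u \<in> ancestors a"
    then obtain s where "a = u @ s" by (auto simp: ancestors_def)
    then have "u = take (length u) a" "length u \<le> length a" by auto
    then show "u \<in> (\<lambda>n. take n a) ` {..length a}" by blast
  qed
  then show ?thesis by (rule finite_subset) auto
qed

lemma ancestors_snoc: "ancestors (v @ [i]) = insert (v @ [i]) (ancestors v)"
proof (intro equalityI subsetI)
  fix u assume "u \<in> ancestors (v @ [i])"
  then obtain s where s: "v @ [i] = u @ s" by (auto simp: ancestors_def)
  then show "u \<in> insert (v @ [i]) (ancestors v)"
    by (cases s rule: rev_cases) (auto simp: ancestors_def)
qed (auto simp: ancestors_def)

lemma tree_vertices_append:
  "v @ [i] \<in> tree_vertices c \<longleftrightarrow> v \<in> tree_vertices c \<and> i < c v"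
  by (auto elim: tree_vertices.cases intro: tree_vertices.child)

lemma tree_vertices_cong:
  assumes "\<And>u. u \<in> ancestors v \<Longrightarrow> c u = c' u"
  shows "v \<in> tree_vertices c \<longleftrightarrow> v \<in> tree_vertices c'"
  using assms
proof (induction v rule: rev_induct)
  case Nil
  show ?case by (simp add: tree_vertices.root)
next
  case (snoc i v)
  have "c u = c' u" if "u \<in> ancestors v" for u
    using that snoc.prems[of u] by (auto simp: ancestors_def)
  moreover have "c v = c' v" using snoc.prems[of v] by (auto simp: ancestors_def)
  ultimately show ?case using snoc.IH by (simp add: tree_vertices_append)
qed

lemma tree_vertices_ancestor:
  "v \<in> tree_vertices c \<Longrightarrow> u \<in> ancestors v \<Longrightarrow> u \<in> tree_vertices c"
proof (induction v rule: rev_induct)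
  case (snoc i v)
  have "u = v @ [i] \<or> u \<in> ancestors v"
    using snoc.prems(2) by (auto simp: ancestors_snoc)
  then show ?case using snoc by (auto simp: tree_vertices_append)
qed (auto simp: ancestors_def)

lemma tree_adj_sym: "tree_adj c u v \<longleftrightarrow> tree_adj c v u"
  by (auto simp: tree_adj_def)

lemma tree_adj_vertex:
  assumes "v \<in> tree_vertices c"
  shows "tree_adj c v w \<longleftrightarrow> (\<exists>i<c v. w = v @ [i]) \<or> (\<exists>i. v = w @ [i])"
  using assms by (auto simp: tree_adj_def tree_vertices_append)

text \<open>A finite explored subtree \<open>D\<close> whose top vertex is \<open>a\<close>; the child counts that matter
  for it are those on \<open>D \<union> ancestors a\<close>.\<close>

definition region :: "(nat list \<Rightarrow> nat) \<Rightarrow> nat list \<Rightarrow> nat list set \<Rightarrow> bool" where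
  "region c a D \<longleftrightarrow> finite D \<and> a \<in> D \<and> a \<in> tree_vertices c \<and>
     (\<forall>v\<in>D. v = a \<or> (\<exists>u i. v = u @ [i] \<and> u \<in> D \<and> i < c u)) \<and>
     (\<forall>v\<in>D. \<exists>s. v = a @ s) \<and> (\<forall>v\<in>D \<union> ancestors a. 0 < c v)"

lemma region_vertex:
  assumes "region c a D"
  shows "v \<in> D \<union> ancestors a \<Longrightarrow> v \<in> tree_vertices c"
proof (induction v rule: length_induct)
  case (1 v)
  show ?case
  proof (cases "v \<in> ancestors a")
    case True
    then show ?thesis using assms tree_vertices_ancestor by (auto simp: region_def)
  next
    case False
    then have v: "v \<in> D" "v \<noteq> a" using 1 by (auto simp: ancestors_def)
    then obtain u i where "v = u @ [i]" "u \<in> D" "i < c u" using assms unfolding region_def by blast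
    then show ?thesis using 1 by (auto simp: tree_vertices_append)
  qed
qed

lemma region_adj:
  assumes "region c a D" "v \<in> D \<union> ancestors a"
  shows "tree_adj c v w \<longleftrightarrow> (\<exists>i<c v. w = v @ [i]) \<or> (\<exists>i. v = w @ [i])"
  using tree_adj_vertex[OF region_vertex[OF assms]] .

lemma region_cong:
  assumes "region c a D" "\<And>v. v \<in> D \<union> ancestors a \<Longrightarrow> c v = c' v"
  shows "region c' a D"
proof -
  have "a \<in> tree_vertices c'"
    using assms tree_vertices_cong[of a c c'] by (auto simp: region_def)
  then show ?thesis using assms unfolding region_def by (metis UnCI)
qed

lemma region_adj_cong:
  assumes "region c a D" "\<And>v. v \<in> D \<union> ancestors a \<Longrightarrow> c v = c' v" "v \<in> D"
  shows "tree_adj c v = tree_adj c' v"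
  using region_adj[OF assms(1)] region_adj[OF region_cong[OF assms(1,2)]] assms(2,3)
  by (auto simp: fun_eq_iff)

text \<open>Every vertex of \<open>D\<close> other than \<open>a\<close> has its parent in
  \<open>D\<close>, so the walk can leave upwards only from \<open>a\<close>. In the downward case
  \<open>w\<close> is not an ancestor of \<open>a\<close>, hence its child count is still
  free.\<close>

lemma region_fresh_cases:
  assumes "region c a D" "v \<in> D" "tree_adj c v w" "w \<notin> D"
  obtains i where "i < c v" "w = v @ [i]" "w \<notin> ancestors a"
    | i where "v = a" "a = w @ [i]"
proof -
  consider i where "i < c v" "w = v @ [i]" | i where "v = w @ [i]"
    using region_adj[OF assms(1)] assms(2,3) by blast
  then show ?thesis
  proof cases
    case 1
    obtain s where "v = a @ s" using assms unfolding region_def by blast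
    then have "w \<notin> ancestors a" using 1 by (auto simp: ancestors_def)
    then show ?thesis using 1 that by blast
  next
    case 2
    then have "v = a" using assms unfolding region_def by (metis butlast_snoc)
    then show ?thesis using 2 that by blast
  qed
qed

text \<open>Revealing the count at \<open>w\<close> leaves all counts on
  \<open>D \<union> ancestors a\<close> alone, so the explored part is undisturbed. No child of
  \<open>w\<close> is explored yet, so all \<open>z\<close> edges down from \<open>w\<close> are
  fresh.\<close>

lemma region_child:
  assumes reg: "region c a D" and v: "v \<in> D" "i < c v" "w = v @ [i]" "w \<notin> D" and z: "0 < z"
  defines "c1 \<equiv> c(w := z)"
  shows "region c1 a (insert w D)"
    and "\<And>y. y \<in> D \<Longrightarrow> tree_adj c1 y = tree_adj c y"
    and "\<And>y. y \<in> D \<Longrightarrow> tree_adj c1 w y \<longleftrightarrow> y = v"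
    and "card (fresh (tree_adj c1) (insert w D) {w}) = z"
proof -
  obtain s where s: "v = a @ s" using assms unfolding region_def by blast
  have wp: "w \<notin> ancestors a" using v s by (auto simp: ancestors_def)
  have agree: "c y = c1 y" if "y \<in> D \<union> ancestors a" for y
    using that wp v by (auto simp: c1_def)
  have reg1: "region c1 a D" by (rule region_cong[OF reg agree])
  have "i < c1 v" using agree[of v] v by auto
  then show r: "region c1 a (insert w D)"
    unfolding region_def
  proof (intro conjI ballI)
    show "finite (insert w D)" "a \<in> insert w D" "a \<in> tree_vertices c1"
      using reg1 by (auto simp: region_def)
    show "y = a \<or> (\<exists>u i. y = u @ [i] \<and> u \<in> insert w D \<and> i < c1 u)" if "y \<in> insert w D" for y
      using that reg1 v(1,3) \<open>i < c1 v\<close> unfolding region_def by blast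
    show "\<exists>s. y = a @ s" if "y \<in> insert w D" for y
      using that reg1 v(3) s unfolding region_def by auto
    show "0 < c1 y" if "y \<in> insert w D \<union> ancestors a" for y
    proof (cases "y = w")
      case True
      then show ?thesis using z by (simp add: c1_def)
    next
      case False
      then show ?thesis using that reg1 unfolding region_def by blast
    qed
  qed
  show "tree_adj c1 y = tree_adj c y" if "y \<in> D" for y
    using region_adj_cong[OF reg agree that] by simp
  have nochild: "w @ [j] \<notin> D" for j
  proof
    assume "w @ [j] \<in> D"
    moreover have "w @ [j] \<noteq> a" using v s by auto
    ultimately have "w \<in> D" using reg unfolding region_def by (metis butlast_snoc)
    then show False using v by simp
  qed
  have adjw: "tree_adj c1 w y \<longleftrightarrow> (\<exists>j<z. y = w @ [j]) \<or> y = v" for y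
    using region_adj[OF r, of w y] v(3) by (auto simp: c1_def)
  show "tree_adj c1 w y \<longleftrightarrow> y = v" if "y \<in> D" for y
    using that nochild adjw[of y] by auto
  have "fresh (tree_adj c1) (insert w D) {w} = (\<lambda>j. (w, w @ [j])) ` {..<z}"
    using nochild v(1) by (auto simp: fresh_def adjw)
  then show "card (fresh (tree_adj c1) (insert w D) {w}) = z"
    by (simp add: card_image inj_on_def)
qed

text \<open>The count of the parent was frozen from the start. Climbing therefore reveals nothing,
  and the set of frozen vertices is unchanged.\<close>

lemma region_parent:
  assumes reg: "region c a D" and a: "a = w @ [i]"
  shows "region c w (insert w D)"
    and "\<And>y. y \<in> D \<Longrightarrow> tree_adj c w y \<longleftrightarrow> y = a"
    and "insert w D \<union> ancestors w = D \<union> ancestors a"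
    and "w \<notin> D"
proof -
  have len: "length a \<le> length y" if "y \<in> D" for y
    using reg that unfolding region_def by fastforce
  then show wD: "w \<notin> D" using a by fastforce
  have aD: "a \<in> D" using reg by (simp add: region_def)
  have pr: "ancestors a = insert a (ancestors w)"
    by (simp add: a ancestors_snoc)
  have wp: "w \<in> ancestors w" by (simp add: ancestors_def)
  show u: "insert w D \<union> ancestors w = D \<union> ancestors a" using aD pr wp by auto
  have wt: "w \<in> tree_vertices c \<and> i < c w"
    using reg by (simp add: region_def a tree_vertices_append)
  show r: "region c w (insert w D)"
    unfolding region_def
  proof (intro conjI ballI)
    show "finite (insert w D)" "w \<in> insert w D" "w \<in> tree_vertices c"
      using reg wt by (auto simp: region_def)
    show "v = w \<or> (\<exists>u i. v = u @ [i] \<and> u \<in> insert w D \<and> i < c u)" if "v \<in> insert w D" for v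
      using that reg wt a unfolding region_def by blast
    show "\<exists>s. v = w @ s" if "v \<in> insert w D" for v
      using that reg a unfolding region_def by fastforce
    show "0 < c v" if "v \<in> insert w D \<union> ancestors w" for v
      using that reg u unfolding region_def by auto
  qed
  show "tree_adj c w y \<longleftrightarrow> y = a" if y: "y \<in> D" for y
  proof -
    have "tree_adj c w y \<longleftrightarrow> (\<exists>j<c w. y = w @ [j]) \<or> (\<exists>j. w = y @ [j])"
      by (rule region_adj[OF r]) simp
    moreover have "w \<noteq> y @ [j]" for j using len[OF y] a by auto
    moreover have "y = a" if "y = w @ [j]" for j
    proof -
      obtain s where "y = a @ s" using reg y unfolding region_def by blast
      then show ?thesis using that a by auto
    qed
    ultimately show ?thesis using wt a by auto
  qed
qed

lemma region_finite_fresh: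
  assumes "region c a D" "B \<subseteq> D"
  shows "finite (fresh (tree_adj c) D B)"
proof -
  have "fresh (tree_adj c) D B \<subseteq>
      (\<Union>v\<in>D. (\<lambda>i. (v, v @ [i])) ` {..<c v}) \<union> (\<lambda>v. (v, butlast v)) ` D"
  proof
    fix e assume "e \<in> fresh (tree_adj c) D B"
    then obtain v w where e: "e = (v, w)" "v \<in> D" "tree_adj c v w"
      using assms by (auto simp: fresh_def)
    then consider i where "i < c v" "w = v @ [i]" | i where "v = w @ [i]"
      using region_adj[OF assms(1), of v w] by blast
    then show "e \<in> (\<Union>v\<in>D. (\<lambda>i. (v, v @ [i])) ` {..<c v}) \<union> (\<lambda>v. (v, butlast v)) ` D"
      using e by cases auto
  qed
  moreover have "finite D" using assms by (simp add: region_def)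
  ultimately show ?thesis by (auto intro: finite_subset)
qed

text \<open>A deepest vertex of \<open>D\<close> has a child, as counts on \<open>D\<close> are
  positive, and this child lies outside \<open>D\<close>. So the walk is never stuck when its path
  is empty.\<close>

lemma region_fresh_ne:
  assumes "region c a D"
  shows "fresh (tree_adj c) D D \<noteq> {}"
proof -
  have D: "finite D" "D \<noteq> {}" using assms by (auto simp: region_def)
  define m where "m = Max (length ` D)"
  obtain v where v: "v \<in> D" "length v = m"
    using Max_in[of "length ` D"] D unfolding m_def by (metis finite_imageI image_iff image_is_empty)
  have "v @ [0] \<notin> D"
  proof
    assume "v @ [0] \<in> D"
    then have "length (v @ [0]) \<le> m" unfolding m_def using D by (intro Max_ge) blast+
    then show False using v by simp
  qed
  moreover have "tree_adj c v (v @ [0])"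
    using region_adj[OF assms, of v] v assms by (auto simp: region_def)
  ultimately have "(v, v @ [0]) \<in> fresh (tree_adj c) D D" using v by (simp add: fresh_def)
  then show ?thesis by auto
qed

section \<open>Expected visits for a fixed graph\<close>

text \<open>The unit interval splits into \<open>card S\<close> intervals of equal length, one for
  each list index, so the enumeration behind \<open>pick\<close> does not affect the
  average.\<close>

lemma nn_integral_uniform_pick:
  fixes F :: "'a \<Rightarrow> ennreal"
  assumes S: "finite S" "S \<noteq> {}"
  shows "(\<integral>\<^sup>+u. F (pick S u) \<partial>uniform_measure lborel {0..<1}) = (\<Sum>e\<in>S. F e) / of_nat (card S)"
proof -
  define xs where "xs = enum_list S"
  define n where "n = card S"
  have "distinct xs \<and> set xs = S"
    unfolding xs_def enum_list_def by (rule someI_ex) (use finite_distinct_list[OF S(1)] in auto)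
  then have xs: "distinct xs" "set xs = S" "length xs = n"
    by (auto simp: n_def distinct_card[symmetric])
  have n: "0 < n" using S by (auto simp: n_def card_gt_0_iff)
  have p: "pick S u = xs ! nat \<lfloor>u * real n\<rfloor>" for u by (simp add: pick_def xs_def n_def)
  have floor_meas: "(\<lambda>u. nat \<lfloor>u * real n\<rfloor>) \<in> measurable borel (count_space UNIV)" by measurable
  have [measurable]: "(\<lambda>u. F (pick S u)) \<in> borel_measurable borel"
    unfolding p by (rule measurable_compose[OF floor_meas]) simp
  have dec: "F (pick S u) * indicator {0..<1} u
      = (\<Sum>i<n. F (xs ! i) * indicator {real i / real n ..< (real i + 1) / real n} u)" for u :: real
  proof (cases "u \<in> {0..<1}")
    case True
    define j where "j = nat \<lfloor>u * real n\<rfloor>"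
    have un: "0 \<le> u * real n" "u * real n < real n" using True n by auto
    have j: "j < n" using un n unfolding j_def by (simp add: nat_less_iff floor_less_iff)
    have mem: "u \<in> {real i / real n ..< (real i + 1) / real n} \<longleftrightarrow> i = j" for i
    proof -
      have "u \<in> {real i / real n ..< (real i + 1) / real n}
          \<longleftrightarrow> real_of_int (int i) \<le> u * real n \<and> u * real n < real_of_int (int i) + 1"
        using n by (auto simp: field_simps)
      also have "\<dots> \<longleftrightarrow> \<lfloor>u * real n\<rfloor> = int i" by (auto simp: floor_eq_iff)
      also have "\<dots> \<longleftrightarrow> i = j" using un by (auto simp: j_def)
      finally show ?thesis .
    qed
    have "(\<Sum>i<n. F (xs ! i) * indicator {real i / real n ..< (real i + 1) / real n} u)
        = (\<Sum>i<n. if i = j then F (xs ! j) else 0)"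
      unfolding indicator_def mem by (intro sum.cong) auto
    also have "\<dots> = F (xs ! j)" using j by simp
    finally show ?thesis using True unfolding p j_def[symmetric] by simp
  next
    case False
    have "u \<notin> {real i / real n ..< (real i + 1) / real n}" if "i < n" for i
    proof
      assume "u \<in> {real i / real n ..< (real i + 1) / real n}"
      then have "real i / real n \<le> u" "u < (real i + 1) / real n" by auto
      moreover have "(real i + 1) / real n \<le> 1" using that n by (simp add: field_simps)
      moreover have "0 \<le> real i / real n" by simp
      ultimately have "u \<in> {0..<1}" by (simp only: atLeastLessThan_iff) linarith
      then show False using False by simp
    qed
    then have "(\<Sum>i<n. F (xs ! i) * indicator {real i / real n ..< (real i + 1) / real n} u) = 0"
      by (intro sum.neutral) (auto simp del: atLeastLessThan_iff)
    then show ?thesis using False by simp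
  qed
  have len: "emeasure lborel {real i / real n ..< (real i + 1) / real n} = ennreal (1 / real n)" for i
    using n by (subst emeasure_lborel_Ico) (auto simp: field_simps divide_right_mono diff_divide_distrib[symmetric])
  have "(\<integral>\<^sup>+u. F (pick S u) \<partial>uniform_measure lborel {0..<1})
      = (\<integral>\<^sup>+u. F (pick S u) * indicator {0..<1} u \<partial>lborel)"
    by (subst nn_integral_uniform_measure) (auto simp: divide_ennreal_def)
  also have "\<dots> = (\<Sum>i<n. F (xs ! i) * ennreal (1 / real n))"
    unfolding dec by (subst nn_integral_sum) (auto simp: nn_integral_cmult_indicator len)
  also have "\<dots> = (\<Sum>i<n. F (xs ! i)) * ennreal (1 / real n)" by (simp add: sum_distrib_right)
  also have "(\<Sum>i<n. F (xs ! i)) = (\<Sum>e\<in>S. F e)"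
    by (rule sum.reindex_bij_betw) (use xs in \<open>auto intro: bij_betw_nth\<close>)
  also have "ennreal (1 / real n) = 1 / of_nat n"
    using n by (simp add: divide_ennreal[symmetric] ennreal_of_nat_eq_real_of_nat)
  finally show ?thesis by (simp add: n_def ennreal_times_divide)
qed

text \<open>Consumes the stream from the front and starts anywhere, as a first-step decomposition
  requires; \<open>lcrw_state\<close> recurses from the last step instead.\<close>

primrec lcrw_run :: "('v \<Rightarrow> 'v \<Rightarrow> bool) \<Rightarrow> 'v \<Rightarrow> ('v \<Rightarrow> 'v set) \<times> ('v \<times> 'v) list
      \<Rightarrow> real stream \<Rightarrow> nat \<Rightarrow> ('v \<Rightarrow> 'v set) \<times> ('v \<times> 'v) list" where
  "lcrw_run E x st \<omega> 0 = st"
| "lcrw_run E x st \<omega> (Suc n) = lcrw_run E x (lcrw_step E x st (shd \<omega>)) (stl \<omega>) n"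

lemma lcrw_run_Suc: "lcrw_run E x st \<omega> (Suc n) = lcrw_step E x (lcrw_run E x st \<omega> n) (\<omega> !! n)"
  by (induction n arbitrary: st \<omega>) auto

lemma lcrw_state_run: "lcrw_state E x \<omega> n = lcrw_run E x (\<lambda>v. {v}, []) \<omega> n"
  by (induction n) (simp_all add: lcrw_run_Suc del: lcrw_run.simps(2))

text \<open>States contain functions and may be uncountably many. Restricting to the countable range
  of one step allows measurable composition along the stream.\<close>

lemma measurable_lcrw_step:
  "lcrw_step E x st \<in> measurable borel (count_space (range (lcrw_step E x st)))"
  and countable_lcrw_step: "countable (range (lcrw_step E x st))"
proof -
  define S where "S = outs E (last (blocks x st))"
  have *: "lcrw_step E x st \<in> measurable borel (count_space UNIV) \<and> countable (range (lcrw_step E x st))"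
  proof (cases "S = {} \<or> infinite S")
    case True
    then have "lcrw_step E x st = (\<lambda>u. st)"
      by (auto simp: lcrw_step_move S_def Let_def fun_eq_iff)
    then show ?thesis by simp
  next
    case False
    define h where "h i = lcrw_move x st (enum_list S ! i)" for i
    have eq: "lcrw_step E x st = (\<lambda>u. h (nat \<lfloor>u * real (card S)\<rfloor>))"
      using False by (auto simp: lcrw_step_move S_def Let_def fun_eq_iff h_def pick_def)
    have fm: "(\<lambda>u. nat \<lfloor>u * real (card S)\<rfloor>) \<in> measurable borel (count_space UNIV)" by measurable
    have "range (lcrw_step E x st) \<subseteq> range h" unfolding eq by auto
    then have "countable (range (lcrw_step E x st))" by (rule countable_subset) auto
    moreover have "lcrw_step E x st \<in> measurable borel (count_space UNIV)"
      unfolding eq by (rule measurable_compose[OF fm]) simp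
    ultimately show ?thesis by simp
  qed
  then show c: "countable (range (lcrw_step E x st))" by simp
  show "lcrw_step E x st \<in> measurable borel (count_space (range (lcrw_step E x st)))"
  proof (subst measurable_count_space_eq_countable[OF c], intro conjI ballI)
    fix y
    show "lcrw_step E x st -` {y} \<inter> space borel \<in> sets borel"
      using measurable_sets[of "lcrw_step E x st" borel "count_space UNIV" "{y}"] * by simp
  qed simp
qed

lemma measurable_lcrw_run:
  "(\<lambda>\<omega>. lcrw_run E x st \<omega> n) \<in> measurable (stream_space borel) (count_space UNIV)"
proof (induction n arbitrary: st)
  case (Suc n)
  have s: "shd \<in> measurable (stream_space borel) (borel :: real measure)"
    and t: "stl \<in> measurable (stream_space borel) (stream_space (borel :: real measure))"
    by measurable
  show ?case unfolding lcrw_run.simps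
    by (rule measurable_compose_countable'[where g = "\<lambda>\<omega>. lcrw_step E x st (shd \<omega>)",
          OF measurable_compose[OF t Suc.IH] measurable_compose[OF s measurable_lcrw_step]
             countable_lcrw_step])
qed simp

lemma sets_unif_stream: "sets unif_stream = sets (stream_space borel)"
  unfolding unif_stream_def by (rule sets_stream_space_cong) simp

text \<open>The expected number of times before \<open>n\<close> at which the path has length
  \<open>k\<close>, for a fixed graph. The recursion through finite sums allows averaging over the
  tree without measurability jointly in tree and stream.\<close>

primrec visits :: "nat \<Rightarrow> 'v \<Rightarrow> nat \<Rightarrow> ('v \<Rightarrow> 'v \<Rightarrow> bool)
      \<Rightarrow> ('v \<Rightarrow> 'v set) \<times> ('v \<times> 'v) list \<Rightarrow> ennreal" where
  "visits k x 0 E st = 0"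
| "visits k x (Suc n) E st = (if length (snd st) = k then 1 else 0) +
     (let S = outs E (last (blocks x st)) in
      if S = {} \<or> infinite S then visits k x n E st
      else (\<Sum>e\<in>S. visits k x n E (lcrw_move x st e)) / of_nat (card S))"

lemma nn_integral_visits:
  "(\<integral>\<^sup>+\<omega>. (\<Sum>i<n. if length (snd (lcrw_run E x st \<omega> i)) = k then 1 else 0) \<partial>unif_stream)
     = visits k x n E st"
proof (induction n arbitrary: st)
  case (Suc n)
  let ?U = "uniform_measure lborel {0..<1::real}"
  interpret U: prob_space ?U by (rule prob_space_uniform_measure) auto
  interpret UU: prob_space unif_stream
    unfolding unif_stream_def by (rule U.prob_space_stream_space)
  define f :: "_ \<Rightarrow> nat \<Rightarrow> _ \<Rightarrow> ennreal" where "f st n \<omega> =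
    (\<Sum>i<n. if length (snd (lcrw_run E x st \<omega> i)) = k then 1 else 0)" for st n \<omega>
  have [measurable]: "f st n \<in> borel_measurable unif_stream" for st n
  proof -
    have "(\<lambda>\<omega>. (if length (snd (lcrw_run E x st \<omega> i)) = k then 1 else 0 :: ennreal))
        \<in> borel_measurable (stream_space borel)" for i
      by (rule measurable_compose[OF measurable_lcrw_run]) simp
    then show ?thesis
      unfolding f_def measurable_cong_sets[OF sets_unif_stream refl] by (intro borel_measurable_sum) auto
  qed
  have f: "f st (Suc n) (u ## \<omega>) = (if length (snd st) = k then 1 else 0)
      + f (lcrw_step E x st u) n \<omega>" for u \<omega>
    unfolding f_def by (subst sum.lessThan_Suc_shift) simp
  have "(\<integral>\<^sup>+\<omega>. f st (Suc n) \<omega> \<partial>unif_stream) = (\<integral>\<^sup>+u. \<integral>\<^sup>+\<omega>. f st (Suc n) (u ## \<omega>) \<partial>unif_stream \<partial>?U)"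
    unfolding unif_stream_def
    by (rule U.nn_integral_stream_space) (auto simp: unif_stream_def[symmetric])
  also have "\<dots> = (\<integral>\<^sup>+u. (if length (snd st) = k then 1 else 0) + visits k x n E (lcrw_step E x st u) \<partial>?U)"
    unfolding f by (subst nn_integral_add) (auto simp: Suc.IH[folded f_def] UU.emeasure_space_1 simp del: if_split_asm)
  also have "\<dots> = visits k x (Suc n) E st"
  proof -
    define S where "S = outs E (last (blocks x st))"
    have "(\<lambda>u. visits k x n E (lcrw_step E x st u)) \<in> borel_measurable ?U"
    proof -
      have "(\<lambda>u. visits k x n E (lcrw_step E x st u)) \<in> borel_measurable borel"
        by (rule measurable_compose[OF measurable_lcrw_step]) simp
      then show ?thesis by simp
    qed
    then have "(\<integral>\<^sup>+u. (if length (snd st) = k then 1 else 0) + visits k x n E (lcrw_step E x st u) \<partial>?U)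
       = (if length (snd st) = k then 1 else 0) + (\<integral>\<^sup>+u. visits k x n E (lcrw_step E x st u) \<partial>?U)"
      by (subst nn_integral_add) (auto simp: U.emeasure_space_1)
    moreover have "(\<integral>\<^sup>+u. visits k x n E (lcrw_step E x st u) \<partial>?U)
      = (if S = {} \<or> infinite S then visits k x n E st
      else (\<Sum>e\<in>S. visits k x n E (lcrw_move x st e)) / of_nat (card S))"
      unfolding lcrw_step_move S_def[symmetric] Let_def
      using nn_integral_uniform_pick[of S "\<lambda>e. visits k x n E (lcrw_move x st e)"]
      by (cases "S = {} \<or> infinite S") (simp_all add: U.emeasure_space_1)
    ultimately show ?thesis by (simp add: S_def Let_def)
  qed
  finally show ?case unfolding f_def .
qed simp

lemma lcrw_step_path:
  "snd (lcrw_step E x st u) = snd st \<or> (\<exists>e. snd (lcrw_step E x st u) = snd st @ [e])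
    \<or> (\<exists>j. snd (lcrw_step E x st u) = take j (snd st))"
  unfolding lcrw_step_move lcrw_move_def Let_def by auto

text \<open>Finitely many visits to each length push the length above every level, by induction on
  the level. A step only appends or truncates, so it cannot alter the first \<open>k\<close> edges
  while the length stays at least \<open>k\<close>.\<close>

lemma path_converges_lcrw:
  assumes "\<And>k. finite {i. length (snd (lcrw_state E x \<omega> i)) = k}"
  shows "path_converges (\<lambda>n. snd (lcrw_state E x \<omega> n))"
proof -
  define P where "P n = snd (lcrw_state E x \<omega> n)" for n
  have ev: "\<exists>n0. \<forall>n\<ge>n0. k \<le> length (P n)" for k
  proof (induction k)
    case (Suc k)
    then obtain n0 where n0: "\<forall>n\<ge>n0. k \<le> length (P n)" by auto
    obtain n1 where n1: "\<forall>i\<in>{i. length (P i) = k}. i < n1"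
      using assms[of k] unfolding P_def[symmetric] finite_nat_set_iff_bounded by auto
    have "\<forall>n\<ge>max n0 n1. Suc k \<le> length (P n)"
      using n0 n1 by (auto simp: Suc_le_eq order_less_le)
    then show ?case by blast
  qed auto
  show ?thesis
    unfolding path_converges_def P_def[symmetric]
  proof
    fix k
    obtain n0 where n0: "\<forall>n\<ge>n0. k \<le> length (P n)" using ev by blast
    have "take k (P n) = take k (P n0)" if "n \<ge> n0" for n
      using that
    proof (induction n rule: dec_induct)
      case (step n)
      have k: "k \<le> length (P n)" "k \<le> length (P (Suc n))" using n0 step by auto
      have "P (Suc n) = P n \<or> (\<exists>e. P (Suc n) = P n @ [e]) \<or> (\<exists>j. P (Suc n) = take j (P n))"
        using lcrw_step_path[of E x "lcrw_state E x \<omega> n" "\<omega> !! n"] by (simp add: P_def)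
      then have "take k (P (Suc n)) = take k (P n)"
        using k by (auto simp: min_absorb1 min_absorb2)
      then show ?case using step by simp
    qed simp
    then show "\<exists>n0. \<forall>n\<ge>n0. k \<le> length (P n) \<and> take k (P n) = take k (P n0)"
      using n0 by blast
  qed
qed

text \<open>By monotone convergence the bound controls the expected total number of visits to length
  \<open>k\<close>, which is then almost surely finite.\<close>

lemma lcrw_transientI:
  assumes "\<And>k. (SUP n. visits k x n E (\<lambda>v. {v}, [])) < \<infinity>"
  shows "lcrw_transient E x"
proof -
  have "AE \<omega> in unif_stream. finite {i. length (snd (lcrw_state E x \<omega> i)) = k}" for k
  proof -
    define g :: "nat \<Rightarrow> real stream \<Rightarrow> ennreal" where
      "g i \<omega> = (if length (snd (lcrw_state E x \<omega> i)) = k then 1 else 0)" for i \<omega>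
    have [measurable]: "g i \<in> borel_measurable unif_stream" for i
    proof -
      have "g i \<in> borel_measurable (stream_space borel)"
        unfolding g_def lcrw_state_run by (rule measurable_compose[OF measurable_lcrw_run]) simp
      then show ?thesis unfolding measurable_cong_sets[OF sets_unif_stream refl] .
    qed
    have "(\<integral>\<^sup>+\<omega>. (SUP n. \<Sum>i<n. g i \<omega>) \<partial>unif_stream) = (SUP n. \<integral>\<^sup>+\<omega>. (\<Sum>i<n. g i \<omega>) \<partial>unif_stream)"
      by (rule nn_integral_monotone_convergence_SUP)
        (auto simp: incseq_def le_fun_def intro!: sum_mono2)
    also have "\<dots> < \<infinity>"
      unfolding g_def lcrw_state_run nn_integral_visits by (rule assms)
    finally have "AE \<omega> in unif_stream. (SUP n. \<Sum>i<n. g i \<omega>) \<noteq> \<infinity>"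
      by (intro nn_integral_PInf_AE) auto
    then show ?thesis
    proof eventually_elim
      case (elim \<omega>)
      let ?A = "{i. length (snd (lcrw_state E x \<omega> i)) = k}"
      have "emeasure (count_space UNIV) ?A = (\<integral>\<^sup>+i. indicator ?A i \<partial>count_space UNIV)" by simp
      also have "\<dots> = (\<Sum>i. indicator ?A i)" by (rule nn_integral_count_space_nat)
      also have "\<dots> = (SUP n. \<Sum>i<n. indicator ?A i)" by (rule suminf_eq_SUP)
      also have "\<dots> = (SUP n. \<Sum>i<n. g i \<omega>)"
      proof -
        have "indicator ?A i = g i \<omega>" for i by (simp add: g_def)
        then show ?thesis by simp
      qed
      finally have "emeasure (count_space UNIV) ?A \<noteq> \<infinity>" using elim by simp
      then show ?case by (metis emeasure_count_space_infinite infinity_ennreal_def subset_UNIV)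
    qed
  qed
  then have "AE \<omega> in unif_stream. \<forall>k. finite {i. length (snd (lcrw_state E x \<omega> i)) = k}"
    by (simp add: AE_all_countable)
  then show ?thesis
    unfolding lcrw_transient_def by eventually_elim (rule path_converges_lcrw, auto)
qed

section \<open>Measurability in the random tree\<close>

lemma measurable_tree_vertices:
  "Measurable.pred (\<Pi>\<^sub>M v\<in>UNIV. count_space UNIV) (\<lambda>c. v \<in> tree_vertices c)"
proof (induction v rule: rev_induct)
  case Nil
  then show ?case by (simp add: tree_vertices.root)
next
  case (snoc i v)
  then show ?case unfolding tree_vertices_append by measurable
qed

lemma measurable_tree_adj:
  "Measurable.pred (\<Pi>\<^sub>M v\<in>UNIV. count_space UNIV) (\<lambda>c. tree_adj c u v)"
proof -
  note measurable_tree_vertices[measurable]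
  show ?thesis unfolding tree_adj_def Bex_def[symmetric] by measurable
qed

lemma measurable_visits:
  "(\<lambda>c. visits k x n (tree_adj c) st) \<in> borel_measurable (\<Pi>\<^sub>M v\<in>UNIV. count_space UNIV)"
proof (induction n arbitrary: st)
  case (Suc n)
  let ?P = "(\<Pi>\<^sub>M v\<in>UNIV. count_space UNIV) :: (nat list \<Rightarrow> nat) measure"
  let ?F = "{S :: (nat list \<times> nat list) set. finite S}"
  note measurable_tree_adj[measurable]
  define B where "B = last (blocks x st)"
  \<comment> \<open>Infinite edge sets are sent to the empty set, which \<open>visits\<close> treats
    in the same way. The values of \<open>g\<close> then form a countable family, and each can be
    handled separately.\<close>
  define g where "g c = (if finite (outs (tree_adj c) B) then outs (tree_adj c) B else {})" for c
  have F: "countable ?F" by (rule countable_Collect_finite)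
  have eqS: "Measurable.pred ?P (\<lambda>c. outs (tree_adj c) B = S)" for S
  proof -
    have "outs (tree_adj c) B = S \<longleftrightarrow> (\<forall>u v. ((u, v) \<in> S) = (u \<in> B \<and> tree_adj c u v \<and> v \<notin> B))" for c
      by (auto simp: outs_def)
    then show ?thesis by simp
  qed
  have fin: "Measurable.pred ?P (\<lambda>c. finite (outs (tree_adj c) B))"
  proof -
    have *: "(\<lambda>c. finite (outs (tree_adj c) B)) = (\<lambda>c. \<exists>xs. outs (tree_adj c) B = set xs)"
      by (metis List.finite_set finite_list)
    show ?thesis unfolding * by (intro pred_intros_countable eqS)
  qed
  have g: "g \<in> measurable ?P (count_space ?F)"
  proof (subst measurable_count_space_eq_countable[OF F], intro conjI ballI)
    show "g \<in> space ?P \<rightarrow> ?F" by (auto simp: g_def)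
    fix S assume "S \<in> ?F"
    have "Measurable.pred ?P (\<lambda>c. finite (outs (tree_adj c) B) \<and> outs (tree_adj c) B = S
        \<or> \<not> finite (outs (tree_adj c) B) \<and> S = {})"
      using fin eqS by measurable
    then have "Measurable.pred ?P (\<lambda>c. g c = S)"
      by (rule measurable_cong[THEN iffD1, rotated]) (auto simp: g_def)
    then have "{c \<in> space ?P. g c = S} \<in> sets ?P" by (simp add: pred_def)
    moreover have "{c \<in> space ?P. g c = S} = g -` {S} \<inter> space ?P" by auto
    ultimately show "g -` {S} \<inter> space ?P \<in> sets ?P" by simp
  qed
  have "(\<lambda>c. (\<lambda>S c. (if length (snd st) = k then 1 else 0) +
      (if S = {} then visits k x n (tree_adj c) st
      else (\<Sum>e\<in>S. visits k x n (tree_adj c) (lcrw_move x st e)) / of_nat (card S))) (g c) c)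
     \<in> borel_measurable ?P"
  proof (rule measurable_compose_countable'[OF _ g F])
    fix S
    note Suc.IH[measurable]
    show "(\<lambda>c. (if length (snd st) = k then 1 else 0) +
      (if S = {} then visits k x n (tree_adj c) st
      else (\<Sum>e\<in>S. visits k x n (tree_adj c) (lcrw_move x st e)) / of_nat (card S)))
      \<in> borel_measurable ?P"
      by (cases "S = {}") measurable
  qed
  then show ?case
    by (rule measurable_cong[THEN iffD1, rotated]) (auto simp: g_def B_def Let_def)
qed simp

section \<open>Averaging over the tree\<close>

lemma prob_space_GW: "prob_space (GW_measure Z)"
  unfolding GW_measure_def by (intro prob_space_PiM) (rule prob_space_measure_pmf)

lemma sets_GW: "sets (GW_measure Z) = sets (\<Pi>\<^sub>M v\<in>UNIV. count_space UNIV)"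
  unfolding GW_measure_def by (intro sets_PiM_cong) auto

lemma measurable_GW_component [measurable]:
  "(\<lambda>N. N v) \<in> measurable (GW_measure Z) (count_space UNIV)"
  unfolding measurable_cong_sets[OF sets_GW refl] by (rule measurable_component_singleton) simp

lemma measurable_GW_intro:
  assumes "\<And>v. (\<lambda>y. f y v) \<in> measurable L (count_space UNIV)"
  shows "f \<in> measurable L (GW_measure Z)"
  unfolding GW_measure_def
proof (rule measurable_PiM_single')
  show "(\<lambda>y. f y v) \<in> measurable L (measure_pmf Z)" for v
    using assms[of v] by simp
qed auto

lemma measurable_GW_update [measurable]:
  "(\<lambda>(z, N). N(v := z)) \<in> measurable (measure_pmf Z \<Otimes>\<^sub>M GW_measure Z) (GW_measure Z)"
  by (rule measurable_GW_intro) (auto simp: split_beta' intro: measurable_compose[OF measurable_snd] measurable_compose[OF measurable_fst])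

lemma measurable_GW_override:
  assumes "\<And>v. v \<in> A \<Longrightarrow> (\<lambda>y. g y v) \<in> measurable L (count_space UNIV)"
    "\<And>v. (\<lambda>y. f y v) \<in> measurable L (count_space UNIV)"
  shows "(\<lambda>y. override_on (f y) (g y) A) \<in> measurable L (GW_measure Z)"
proof (rule measurable_GW_intro)
  show "(\<lambda>y. override_on (f y) (g y) A v) \<in> measurable L (count_space UNIV)" for v
    using assms by (cases "v \<in> A") auto
qed

lemma measurable_visits_GW:
  "(\<lambda>c. visits k x n (tree_adj c) st) \<in> borel_measurable (GW_measure Z)"
  unfolding measurable_cong_sets[OF sets_GW refl] by (rule measurable_visits)

text \<open>One coordinate of a product measure may be redrawn independently. The first order of
  integration reveals a new vertex to the walk; both together drive the induction in
  \<open>GW_resample\<close>.\<close>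

lemma GW_update:
  assumes [measurable]: "F \<in> borel_measurable (GW_measure Z)"
  shows "(\<integral>\<^sup>+N. F N \<partial>GW_measure Z)
       = (\<integral>\<^sup>+z. \<integral>\<^sup>+N. F (N(v := z)) \<partial>GW_measure Z \<partial>measure_pmf Z)" (is "?a = ?b")
    and "(\<integral>\<^sup>+N. F N \<partial>GW_measure Z)
       = (\<integral>\<^sup>+N. \<integral>\<^sup>+z. F (N(v := z)) \<partial>measure_pmf Z \<partial>GW_measure Z)" (is "_ = ?c")
proof -
  interpret G: prob_space "GW_measure Z" by (rule prob_space_GW)
  interpret P: pair_sigma_finite "measure_pmf Z" "GW_measure Z" ..
  have d: "distr (measure_pmf Z \<Otimes>\<^sub>M GW_measure Z) (GW_measure Z) (\<lambda>(z, N). N(v := z)) = GW_measure Z"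
    using distr_pair_PiM_eq_PiM[of UNIV "\<lambda>_. measure_pmf Z" v, OF prob_space_measure_pmf prob_space_measure_pmf]
    unfolding GW_measure_def by simp
  have "?a = (\<integral>\<^sup>+N. F N \<partial>distr (measure_pmf Z \<Otimes>\<^sub>M GW_measure Z) (GW_measure Z) (\<lambda>(z, N). N(v := z)))"
    unfolding d ..
  also have "\<dots> = (\<integral>\<^sup>+p. F ((\<lambda>(z, N). N(v := z)) p) \<partial>(measure_pmf Z \<Otimes>\<^sub>M GW_measure Z))"
    by (rule nn_integral_distr) measurable
  finally have 1: "?a = (\<integral>\<^sup>+p. F ((\<lambda>(z, N). N(v := z)) p) \<partial>(measure_pmf Z \<Otimes>\<^sub>M GW_measure Z))" .
  have [measurable]: "(\<lambda>p. F ((\<lambda>(z, N). N(v := z)) p)) \<in> borel_measurable (measure_pmf Z \<Otimes>\<^sub>M GW_measure Z)"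
    by (rule measurable_compose[OF measurable_GW_update assms])
  show "?a = ?b" unfolding 1 by (subst G.nn_integral_fst[symmetric]) auto
  show "?a = ?c" unfolding 1 by (subst P.nn_integral_snd[symmetric]) auto
qed

text \<open>Counts on \<open>A\<close> and off \<open>A\<close> are independent, so they can be
  taken from two samples; coordinates are moved across one at a time.\<close>

lemma GW_resample:
  assumes F: "F \<in> borel_measurable (GW_measure Z)" and A: "finite A"
  shows "(\<integral>\<^sup>+N. F N \<partial>GW_measure Z)
       = (\<integral>\<^sup>+N. \<integral>\<^sup>+N'. F (override_on N' N A) \<partial>GW_measure Z \<partial>GW_measure Z)"
  using A
proof (induction A)
  case empty
  interpret G: prob_space "GW_measure Z" by (rule prob_space_GW)
  show ?case by (simp add: G.emeasure_space_1)
next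
  case (insert v A)
  interpret G: prob_space "GW_measure Z" by (rule prob_space_GW)
  let ?G = "\<lambda>N. \<integral>\<^sup>+N'. F (override_on N' N (insert v A)) \<partial>GW_measure Z"
  have "(\<lambda>p. F (override_on (snd p) (fst p) (insert v A))) \<in> borel_measurable (GW_measure Z \<Otimes>\<^sub>M GW_measure Z)"
    by (rule measurable_compose[OF measurable_GW_override F]) measurable
  then have meas: "?G \<in> borel_measurable (GW_measure Z)"
    by (intro G.borel_measurable_nn_integral) (simp add: split_beta')
  have "(\<integral>\<^sup>+N'. F (override_on N' N A) \<partial>GW_measure Z) = (\<integral>\<^sup>+z. ?G (N(v := z)) \<partial>measure_pmf Z)" for N
  proof -
    have "(\<lambda>N'. F (override_on N' N A)) \<in> borel_measurable (GW_measure Z)"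
      by (rule measurable_compose[OF measurable_GW_override F]) measurable
    then have "(\<integral>\<^sup>+N'. F (override_on N' N A) \<partial>GW_measure Z)
        = (\<integral>\<^sup>+z. \<integral>\<^sup>+N'. F (override_on (N'(v := z)) N A) \<partial>GW_measure Z \<partial>measure_pmf Z)"
      by (rule GW_update(1))
    moreover have "override_on (N'(v := z)) N A = override_on N' (N(v := z)) (insert v A)" for N' z
      using insert(2) by (auto simp: override_on_def fun_eq_iff)
    ultimately show ?thesis by simp
  qed
  then have "(\<integral>\<^sup>+N. F N \<partial>GW_measure Z)
      = (\<integral>\<^sup>+N. \<integral>\<^sup>+z. ?G (N(v := z)) \<partial>measure_pmf Z \<partial>GW_measure Z)"
    using insert by simp
  also have "\<dots> = (\<integral>\<^sup>+N. ?G N \<partial>GW_measure Z)" by (rule GW_update(2)[OF meas, symmetric])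
  finally show ?case .
qed

section \<open>The annealed bound on visits\<close>

lemma average_le:
  fixes b s p :: ennreal
  assumes "0 < m" "of_nat m * b + s \<le> of_nat m * p"
  shows "b + s / of_nat m \<le> p"
proof -
  have m: "(of_nat m :: ennreal) \<noteq> 0" "(of_nat m :: ennreal) \<noteq> \<top>" using assms(1) by auto
  have "b + s / of_nat m = (b * of_nat m + s) / of_nat m"
    using m by (simp add: add_divide_distrib_ennreal mult_divide_eq_ennreal)
  also have "\<dots> \<le> (p * of_nat m) / of_nat m"
    using assms(2) by (intro divide_right_mono_ennreal) (simp add: mult.commute)
  also have "\<dots> = p" using m by (simp add: mult_divide_eq_ennreal)
  finally show ?thesis .
qed

definition fresh_counts :: "(nat list \<Rightarrow> nat) \<Rightarrow> nat list set \<Rightarrow> nat list set list \<Rightarrow> nat list" where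
  "fresh_counts c D bs = map (\<lambda>A. card (fresh (tree_adj c) D A)) bs"

lemma fresh_counts_cong:
  assumes "\<And>v. v \<in> \<Union> (set bs) \<Longrightarrow> tree_adj c v = tree_adj c' v"
  shows "fresh_counts c D bs = fresh_counts c' D bs"
proof -
  have "fresh (tree_adj c) D A = fresh (tree_adj c') D A" if A: "A \<in> set bs" for A
  proof -
    have "tree_adj c v = tree_adj c' v" if "v \<in> A" for v using assms A that by blast
    then show ?thesis by (auto simp: fresh_def)
  qed
  then show ?thesis by (simp add: fresh_counts_def)
qed

text \<open>Child counts are averaged only off \<open>D \<union> ancestors a\<close>: those of the explored vertices have been
  revealed, and those of the ancestors of the start are fixed in advance because conditioning on the start
  being in the tree biases them.\<close>

lemma annealed_visits_le:
  assumes Z: "pmf Z 0 = 0" "pmf Z 1 < 1" and \<kappa>: "\<kappa> = 1 - pmf Z 1"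
    and "region c a D" "lcrw_inv (tree_adj c) x D st"
  shows "(\<integral>\<^sup>+N. visits k x n (tree_adj (override_on N c (D \<union> ancestors a))) st \<partial>GW_measure Z)
     \<le> stack_pot \<kappa> k (fresh_counts c D (blocks x st)) (length a)"
  using assms(4,5)
proof (induction n arbitrary: c a D st)
  case (Suc n)
  interpret G: prob_space "GW_measure Z" by (rule prob_space_GW)
  note reg = Suc.prems(1) and inv = Suc.prems(2)
  have kp: "0 < \<kappa>" using Z \<kappa> by simp
  define R where "R = D \<union> ancestors a"
  \<comment> \<open>The remaining expected visits, with revealed and ancestral counts frozen at
    \<open>c\<close> and all others averaged.\<close>
  define V where "V st' = (\<integral>\<^sup>+N. visits k x n (tree_adj (override_on N c R)) st' \<partial>GW_measure Z)" for st'
  have adj: "tree_adj (override_on N c R) y = tree_adj c y" if "y \<in> D" for N y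
    using region_adj_cong[OF reg _ that, of "override_on N c R"] by (simp add: R_def)
  have [measurable]: "(\<lambda>N. visits k x n (tree_adj (override_on N c R)) st') \<in> borel_measurable (GW_measure Z)" for st'
    by (rule measurable_compose[OF measurable_GW_override measurable_visits_GW]) measurable
  obtain hs B where b: "blocks x st = hs @ [B]" by (rule blocks_snocE)
  have len: "length (snd st) = length hs" using length_blocks[where x = x and st = st] unfolding b by simp
  have D: "D = B \<union> \<Union> (set hs)" using inv b by (auto simp: lcrw_inv_def)
  define Fr where "Fr = fresh (tree_adj c) D B"
  define Bk where "Bk = across (tree_adj c) B (\<Union> (set hs))"
  define f where "f = card Fr"
  define gs where "gs = fresh_counts c D hs"
  have lgs: "length gs = length hs" by (simp add: gs_def fresh_counts_def)
  have fs: "fresh_counts c D (blocks x st) = gs @ [f]"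
    by (simp add: b fresh_counts_def gs_def f_def Fr_def)
  have finF: "finite Fr" unfolding Fr_def by (rule region_finite_fresh[OF reg]) (simp add: D)
  define S where "S = outs (tree_adj c) B"
  have S: "S = Fr \<union> Bk" "Fr \<inter> Bk = {}"
    using outs_eq[OF inv b] by (auto simp: S_def Fr_def Bk_def)
  define I where "I = (\<integral>\<^sup>+z. stack_pot \<kappa> k (gs @ [f - 1, z]) (length a) \<partial>measure_pmf Z)"
  have fresh_le: "V (lcrw_move x st e) \<le> I" if "e \<in> Fr" for e
  proof -
    obtain u w where e: "e = (u, w)" by (cases e)
    have u: "u \<in> B" "u \<in> D" "tree_adj c u w" "w \<notin> D"
      using that D by (auto simp: e Fr_def fresh_def)
    show ?thesis
    proof (rule region_fresh_cases[OF reg u(2-4)])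
      fix i assume i: "i < c u" "w = u @ [i]" "w \<notin> ancestors a"
      have wR: "w \<notin> R" using i u by (simp add: R_def)
      \<comment> \<open>The count at \<open>w\<close> is still free, so it is drawn separately and
        then frozen in \<open>c1\<close>; the induction hypothesis averages over the rest.\<close>
      have "V (lcrw_move x st e)
        = (\<integral>\<^sup>+z. \<integral>\<^sup>+N. visits k x n (tree_adj (override_on (N(w := z)) c R)) (lcrw_move x st e)
             \<partial>GW_measure Z \<partial>measure_pmf Z)"
        unfolding V_def by (rule GW_update(1)) measurable
      also have "\<dots> \<le> I"
        unfolding I_def
      proof (rule nn_integral_mono_AE)
        have "AE z in measure_pmf Z. 0 < z"
          using Z(1) unfolding AE_measure_pmf_iff set_pmf_eq by (metis gr0I mem_Collect_eq)
        then show "AE z in measure_pmf Z.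
            (\<integral>\<^sup>+N. visits k x n (tree_adj (override_on (N(w := z)) c R)) (lcrw_move x st e) \<partial>GW_measure Z)
            \<le> stack_pot \<kappa> k (gs @ [f - 1, z]) (length a)"
        proof eventually_elim
          fix z :: nat assume z: "0 < z"
          define c1 where "c1 = c(w := z)"
          note ch = region_child[OF reg u(2) i(1,2) u(4) z, folded c1_def]
          have inv1: "lcrw_inv (tree_adj c1) x D st"
            by (rule lcrw_inv_cong[OF inv]) (simp add: ch(2))
          have inv2: "lcrw_inv (tree_adj c1) x (insert w D) (lcrw_move x st e)"
            unfolding e by (rule lcrw_inv_fresh[OF inv1 b u(4,1)]) (rule ch(3))
          have fr1: "fresh (tree_adj c1) D B = Fr"
            unfolding Fr_def fresh_def using ch(2) D by auto
          have "fresh_counts c1 (insert w D) (blocks x (lcrw_move x st e))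
            = fresh_counts c1 D hs @ [f - 1, z]"
            unfolding e fresh_counts_def
          proof (subst stack_fresh[OF inv1 b u(4,1)])
            show "tree_adj c1 v w \<longleftrightarrow> v = u" if "v \<in> D" for v
              using ch(3)[OF that] tree_adj_sym by metis
          qed (auto simp: fr1 finF f_def ch(4))
          also have "fresh_counts c1 D hs = gs"
            unfolding gs_def by (rule fresh_counts_cong) (use ch(2) D in auto)
          finally have fc: "fresh_counts c1 (insert w D) (blocks x (lcrw_move x st e)) = gs @ [f - 1, z]" .
          have ov: "override_on (N(w := z)) c R = override_on N c1 (insert w D \<union> ancestors a)" for N
            using wR by (auto simp: override_on_def fun_eq_iff c1_def R_def)
          show "(\<integral>\<^sup>+N. visits k x n (tree_adj (override_on (N(w := z)) c R)) (lcrw_move x st e) \<partial>GW_measure Z)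
            \<le> stack_pot \<kappa> k (gs @ [f - 1, z]) (length a)"
            unfolding ov using Suc.IH[OF ch(1) inv2] unfolding fc .
        qed
      qed
      finally show ?thesis .
    next
      fix i assume ua: "u = a" and i: "a = w @ [i]"
      note pa = region_parent[OF reg i]
      have inv2: "lcrw_inv (tree_adj c) x (insert w D) (lcrw_move x st e)"
        unfolding e by (rule lcrw_inv_fresh[OF inv b u(4,1)]) (simp add: pa(2) ua)
      have "V (lcrw_move x st e)
          \<le> stack_pot \<kappa> k (fresh_counts c (insert w D) (blocks x (lcrw_move x st e))) (length w)"
        using Suc.IH[OF pa(1) inv2] unfolding V_def R_def pa(3) .
      \<comment> \<open>The new tip has no fresh \<open>Z\<close>-distributed count here. Its stack
        is arbitrary, and the ancestor just consumed pays for the comparison with any pushed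
        stack.\<close>
      also have "\<dots> = (\<integral>\<^sup>+z. stack_pot \<kappa> k (fresh_counts c (insert w D) (blocks x (lcrw_move x st e))) (length w) \<partial>measure_pmf Z)"
        by simp
      also have "\<dots> \<le> I"
        unfolding I_def i by (intro nn_integral_mono) (simp add: stack_pot_up[OF kp])
      finally show ?thesis .
    qed
  qed
  have sumF: "(\<Sum>e\<in>Fr. V (lcrw_move x st e)) \<le> of_nat f * I"
    unfolding f_def by (rule sum_bounded_above) (rule fresh_le)
  have bound: "(if length hs = k then 1 else 0) + (\<Sum>e\<in>S. V (lcrw_move x st e)) / of_nat (card S)
      \<le> stack_pot \<kappa> k (gs @ [f]) (length a) \<and> finite S \<and> S \<noteq> {}"
  proof (cases hs rule: rev_cases)
    case Nil
    have SF: "S = Fr" using S Nil by (simp add: Bk_def across_def)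
    have ne: "Fr \<noteq> {}" using region_fresh_ne[OF reg] D Nil by (simp add: Fr_def)
    have f: "0 < f" using ne finF by (simp add: f_def card_gt_0_iff)
    have gs0: "gs = []" using lgs Nil by simp
    have "(if length hs = k then 1 else 0) + (\<Sum>e\<in>S. V (lcrw_move x st e)) / of_nat (card S)
        \<le> stack_pot \<kappa> k [f] (length a)"
      unfolding SF f_def[symmetric]
    proof (rule average_le[OF f])
      have "of_nat f * (if length hs = k then 1 else 0) + (\<Sum>e\<in>Fr. V (lcrw_move x st e))
          \<le> of_nat f * ((if k = 0 then 1 else 0) + I)"
        using sumF Nil by (auto simp: distrib_left add_left_mono)
      also have "\<dots> \<le> of_nat f * stack_pot \<kappa> k [f] (length a)"
        using stack_pot_base_step[OF Z \<kappa> f, of k "length a"]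
        by (intro mult_left_mono) (auto simp: I_def gs0)
      finally show "of_nat f * (if length hs = k then 1 else 0) + (\<Sum>e\<in>Fr. V (lcrw_move x st e))
          \<le> of_nat f * stack_pot \<kappa> k [f] (length a)" .
    qed
    then show ?thesis using SF ne finF gs0 by simp
  next
    case (snoc hs' B')
    have b': "blocks x st = hs' @ [B', B]" using b snoc by simp
    have "linked (tree_adj c) (B # B' # rev hs')" using inv by (simp add: lcrw_inv_def b')
    then obtain e0 where e0: "across (tree_adj c) B (\<Union> (set (B' # rev hs'))) = {e0}" "snd e0 \<in> B'"
      by auto
    \<comment> \<open>Exactly one back edge, whence the \<open>Suc f\<close> choices of the merge
      step.\<close>
    have Bk: "Bk = {e0}" using e0(1) by (simp add: Bk_def snoc Un_commute)
    obtain u w where e0': "e0 = (u, w)" by (cases e0)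
    have w: "w \<in> B'" using e0(2) e0' by simp
    define f' where "f' = card (fresh (tree_adj c) D B')"
    have finF': "finite (fresh (tree_adj c) D B')"
      by (rule region_finite_fresh[OF reg]) (use D snoc in auto)
    have gs': "gs = fresh_counts c D hs' @ [f']" by (simp add: gs_def snoc fresh_counts_def f'_def)
    have fc: "fresh_counts c D (blocks x (lcrw_move x st e0)) = fresh_counts c D hs' @ [f' + f]"
      unfolding e0' fresh_counts_def f'_def f_def Fr_def
      by (rule stack_back[OF inv b' w]) (simp_all add: finF[unfolded Fr_def] finF')
    have back_le: "V (lcrw_move x st e0) \<le> stack_pot \<kappa> k (fresh_counts c D hs' @ [f' + f]) (length a)"
      using Suc.IH[OF reg lcrw_move_back(2)[OF inv b' w, of u]] fc
      unfolding V_def R_def e0' by simp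
    have e0F: "e0 \<notin> Fr" using S(2) Bk by auto
    have card: "card S = Suc f" using S Bk e0F finF by (simp add: f_def)
    have "(if length hs = k then 1 else 0) + (\<Sum>e\<in>S. V (lcrw_move x st e)) / of_nat (card S)
        \<le> stack_pot \<kappa> k (gs @ [f]) (length a)"
      unfolding card
    proof (rule average_le)
      have "(\<Sum>e\<in>S. V (lcrw_move x st e)) = V (lcrw_move x st e0) + (\<Sum>e\<in>Fr. V (lcrw_move x st e))"
        using S Bk e0F finF by simp
      also have "\<dots> \<le> stack_pot \<kappa> k (fresh_counts c D hs' @ [f' + f]) (length a) + of_nat f * I"
        by (intro add_mono back_le sumF)
      finally have "of_nat (Suc f) * (if length hs = k then 1 else 0) + (\<Sum>e\<in>S. V (lcrw_move x st e))
        \<le> of_nat (Suc f) * (if length gs = k then 1 else 0)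
          + stack_pot \<kappa> k (fresh_counts c D hs' @ [f' + f]) (length a) + of_nat f * I"
        unfolding lgs by (simp add: add_left_mono add.assoc del: of_nat_Suc)
      also have "\<dots> \<le> of_nat (Suc f) * stack_pot \<kappa> k (gs @ [f]) (length a)"
        unfolding I_def by (rule stack_pot_merge_step[OF Z \<kappa> gs'])
      finally show "of_nat (Suc f) * (if length hs = k then 1 else 0) + (\<Sum>e\<in>S. V (lcrw_move x st e))
        \<le> of_nat (Suc f) * stack_pot \<kappa> k (gs @ [f]) (length a)" .
    qed simp
    then show ?thesis using S Bk finF by simp
  qed
  \<comment> \<open>Adjacency at explored vertices is already frozen, so the set of choices is the
    same for all \<open>N\<close> and the average passes inside the sum.\<close>
  have "outs (tree_adj (override_on N c R)) (last (blocks x st)) = S" for N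
    unfolding S_def b outs_def using adj D by auto
  then have "(\<integral>\<^sup>+N. visits k x (Suc n) (tree_adj (override_on N c R)) st \<partial>GW_measure Z)
     = (\<integral>\<^sup>+N. (if length hs = k then 1 else 0)
         + (\<Sum>e\<in>S. visits k x n (tree_adj (override_on N c R)) (lcrw_move x st e)) / of_nat (card S) \<partial>GW_measure Z)"
    using bound len by (simp add: Let_def)
  also have "\<dots> = (if length hs = k then 1 else 0) + (\<Sum>e\<in>S. V (lcrw_move x st e)) / of_nat (card S)"
    unfolding V_def
    by (subst nn_integral_add) (auto simp: nn_integral_divide nn_integral_sum G.emeasure_space_1)
  finally show ?case using bound unfolding fs R_def by simp
qed simp

text \<open>Whether \<open>x\<close> is a vertex depends only on counts at its ancestors. Freezing
  these and averaging the rest puts \<open>annealed_visits_le\<close> at the initial state, with a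
  bound independent of \<open>n\<close>. The map \<open>T\<close> covers both tree models at once:
  it may change ancestral counts but must pass the resampled ones through.\<close>

lemma annealed_visits_from:
  assumes Z: "pmf Z 0 = 0" "pmf Z 1 < 1" and \<kappa>: "\<kappa> = 1 - pmf Z 1"
    and T: "T \<in> measurable (GW_measure Z) (GW_measure Z)"
    and T_override: "\<And>N N'. T (override_on N' N (ancestors x)) = override_on N' (T N) (ancestors x)"
    and T_pos: "\<And>N v. (\<forall>v. 0 < N v) \<Longrightarrow> 0 < T N v"
  shows "(\<integral>\<^sup>+N. (if x \<in> tree_vertices (T N) then visits k x n (tree_adj (T N)) (\<lambda>v. {v}, []) else 0)
      \<partial>GW_measure Z) \<le> (ennreal (4 / \<kappa>) + 1) * of_nat (Suc (length x))"
proof -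
  interpret G: prob_space "GW_measure Z" by (rule prob_space_GW)
  let ?K = "(ennreal (4 / \<kappa>) + 1) * of_nat (Suc (length x))"
  define H where "H c = (if x \<in> tree_vertices c then visits k x n (tree_adj c) (\<lambda>v. {v}, []) else 0)" for c
  have pos: "AE N in GW_measure Z. \<forall>v. 0 < N v"
    unfolding AE_all_countable
  proof
    fix v
    have "AE z in measure_pmf Z. 0 < z"
      using Z(1) unfolding AE_measure_pmf_iff set_pmf_eq by (metis gr0I mem_Collect_eq)
    then show "AE N in GW_measure Z. 0 < N v"
      unfolding GW_measure_def by (intro AE_PiM_component) (auto intro: prob_space_measure_pmf)
  qed
  have H: "H \<in> borel_measurable (GW_measure Z)"
    unfolding H_def
  proof (rule measurable_If)
    show "{c \<in> space (GW_measure Z). x \<in> tree_vertices c} \<in> sets (GW_measure Z)"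
      using measurable_tree_vertices[of x] unfolding pred_def sets_GW by (simp add: GW_measure_def space_PiM)
  qed (auto intro: measurable_visits_GW)
  have HT: "(\<lambda>N. H (T N)) \<in> borel_measurable (GW_measure Z)"
    by (rule measurable_compose[OF T H])
  have "(\<integral>\<^sup>+N. H (T N) \<partial>GW_measure Z)
      = (\<integral>\<^sup>+N. \<integral>\<^sup>+N'. H (override_on N' (T N) (ancestors x)) \<partial>GW_measure Z \<partial>GW_measure Z)"
    unfolding GW_resample[OF HT finite_ancestors[of x]] T_override ..
  also have "\<dots> \<le> (\<integral>\<^sup>+N. ?K \<partial>GW_measure Z)"
  proof (rule nn_integral_mono_AE, use pos in eventually_elim)
    fix N :: "nat list \<Rightarrow> nat" assume N: "\<forall>v. 0 < N v"
    have tv: "x \<in> tree_vertices (override_on N' (T N) (ancestors x)) \<longleftrightarrow> x \<in> tree_vertices (T N)" for N'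
      by (rule tree_vertices_cong) simp
    show "(\<integral>\<^sup>+N'. H (override_on N' (T N) (ancestors x)) \<partial>GW_measure Z) \<le> ?K"
    proof (cases "x \<in> tree_vertices (T N)")
      case True
      have x: "x \<in> ancestors x" by (simp add: ancestors_def)
      have reg: "region (T N) x {x}" using True T_pos[OF N] by (auto simp: region_def)
      have "(\<integral>\<^sup>+N'. H (override_on N' (T N) (ancestors x)) \<partial>GW_measure Z)
        = (\<integral>\<^sup>+N'. visits k x n (tree_adj (override_on N' (T N) ({x} \<union> ancestors x))) (\<lambda>v. {v}, []) \<partial>GW_measure Z)"
        using True x by (simp add: H_def tv insert_absorb)
      also have "\<dots> \<le> stack_pot \<kappa> k (fresh_counts (T N) {x} (blocks x (\<lambda>v. {v}, []))) (length x)"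
        by (rule annealed_visits_le[OF Z \<kappa> reg lcrw_inv_init])
      also have "\<dots> \<le> ?K" by (rule stack_pot_le) (use Z \<kappa> in simp)
      finally show ?thesis .
    qed (simp add: H_def tv)
  qed
  also have "\<dots> = ?K" by (simp add: G.emeasure_space_1)
  finally show ?thesis by (simp add: H_def)
qed

section \<open>From annealed bounds to almost sure transience\<close>

lemma visits_mono: "incseq (\<lambda>n. visits k x n E st)"
  unfolding nn_integral_visits[symmetric] incseq_def
  by (intro allI impI nn_integral_mono sum_mono2) auto

text \<open>The annealed bound is uniform in \<open>n\<close>, so the total expected visits are
  finite for almost every tree. There are countably many pairs of a start \<open>x\<close> and a
  level \<open>k\<close>, so the exceptional null sets can be united.\<close>

lemma AE_GW_transient:
  assumes Z: "pmf Z 0 = 0" "pmf Z 1 < 1"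
    and T: "T \<in> measurable (GW_measure Z) (GW_measure Z)"
    and T_override: "\<And>x N N'. T (override_on N' N (ancestors x)) = override_on N' (T N) (ancestors x)"
    and T_pos: "\<And>N v. (\<forall>v. 0 < N v) \<Longrightarrow> 0 < T N v"
  shows "AE N in GW_measure Z. \<forall>x\<in>tree_vertices (T N). lcrw_transient (tree_adj (T N)) x"
proof -
  have "AE N in GW_measure Z. x \<in> tree_vertices (T N)
      \<longrightarrow> (SUP n. visits k x n (tree_adj (T N)) (\<lambda>v. {v}, [])) < \<infinity>" for x k
  proof -
    define H where "H n N = (if x \<in> tree_vertices (T N) then visits k x n (tree_adj (T N)) (\<lambda>v. {v}, []) else 0)" for n N
    have [measurable]: "H n \<in> borel_measurable (GW_measure Z)" for n
      unfolding H_def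
    proof (rule measurable_If)
      have "Measurable.pred (GW_measure Z) (\<lambda>c. x \<in> tree_vertices c)"
        unfolding measurable_cong_sets[OF sets_GW refl] by (rule measurable_tree_vertices)
      from measurable_compose[OF T this]
      show "{N \<in> space (GW_measure Z). x \<in> tree_vertices (T N)} \<in> sets (GW_measure Z)"
        by (simp add: pred_def)
      show "(\<lambda>N. visits k x n (tree_adj (T N)) (\<lambda>v. {v}, [])) \<in> borel_measurable (GW_measure Z)"
        by (rule measurable_compose[OF T measurable_visits_GW])
    qed auto
    have "(\<integral>\<^sup>+N. (SUP n. H n N) \<partial>GW_measure Z) = (SUP n. \<integral>\<^sup>+N. H n N \<partial>GW_measure Z)"
    proof (rule nn_integral_monotone_convergence_SUP)
      show "incseq H" by (auto simp: H_def incseq_def le_fun_def intro!: incseqD[OF visits_mono])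
    qed measurable
    also have "\<dots> \<le> (ennreal (4 / (1 - pmf Z 1)) + 1) * of_nat (Suc (length x))"
      unfolding H_def by (rule SUP_least) (rule annealed_visits_from[OF Z refl T T_override T_pos])
    also have "\<dots> < \<infinity>" by (simp add: ennreal_mult_less_top of_nat_less_top)
    finally have "AE N in GW_measure Z. (SUP n. H n N) \<noteq> \<infinity>"
      by (intro nn_integral_PInf_AE) auto
    then show ?thesis
    proof eventually_elim
      case (elim N)
      show ?case
      proof
        assume "x \<in> tree_vertices (T N)"
        then have "(SUP n. visits k x n (tree_adj (T N)) (\<lambda>v. {v}, [])) \<noteq> \<infinity>"
          using elim unfolding H_def by simp
        then show "(SUP n. visits k x n (tree_adj (T N)) (\<lambda>v. {v}, [])) < \<infinity>"
          by (metis less_top infinity_ennreal_def)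
      qed
    qed
  qed
  then have "AE N in GW_measure Z. \<forall>x k. x \<in> tree_vertices (T N)
      \<longrightarrow> (SUP n. visits k x n (tree_adj (T N)) (\<lambda>v. {v}, [])) < \<infinity>"
    unfolding AE_all_countable by blast
  then show ?thesis
    by eventually_elim (auto intro: lcrw_transientI)
qed

lemma agw_children_measurable: "agw_children \<in> measurable (GW_measure Z) (GW_measure Z)"
proof (rule measurable_GW_intro)
  show "(\<lambda>N. agw_children N v) \<in> measurable (GW_measure Z) (count_space UNIV)" for v
  proof (cases "v = []")
    case True
    have "(\<lambda>N. Suc (N [])) \<in> measurable (GW_measure Z) (count_space UNIV)"
      by (rule measurable_compose[OF measurable_GW_component]) simp
    then show ?thesis using True by (simp add: agw_children_def)
  qed (simp add: agw_children_def)
qed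

lemma root_degree_agw: "root_degree (agw_children N) = Suc (N [])"
proof -
  have "tree_adj (agw_children N) [] v \<longleftrightarrow> (\<exists>i<Suc (N []). v = [i])" for v
    using tree_adj_vertex[OF tree_vertices.root, of "agw_children N" v] by (simp add: agw_children_def)
  then have "{v. tree_adj (agw_children N) [] v} = (\<lambda>i. [i]) ` {..<Suc (N [])}" by auto
  then show ?thesis by (simp add: root_degree_def card_image inj_on_def)
qed

text \<open>Otherwise \<open>Z\<close> is almost surely 1 and has mean 1.\<close>

lemma pmf_1_less_1:
  assumes "1 < measure_pmf.expectation Z real"
  shows "pmf Z 1 < 1"
proof (rule ccontr)
  assume "\<not> pmf Z 1 < 1"
  then have "measure_pmf.prob Z {1} = 1"
    using pmf_le_1[of Z 1] by (simp add: measure_pmf_single)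
  then have "AE z in measure_pmf Z. z \<in> {1}" by (subst (asm) measure_pmf.prob_eq_1) auto
  then have "measure_pmf.expectation Z real = measure_pmf.expectation Z (\<lambda>_. 1)"
    by (intro integral_cong_AE) auto
  then show False using assms by simp
qed

theorem mainTheorem5:
  fixes Z :: "nat pmf"
  assumes "integrable (measure_pmf Z) real"
    and "1 < measure_pmf.expectation Z real"
    and "pmf Z 0 = 0"
  shows "(AE N in GW_measure Z. \<forall>x\<in>tree_vertices N. lcrw_transient (tree_adj N) x)
       \<and> (AE N in UGW_measure Z. \<forall>x\<in>tree_vertices (agw_children N).
              lcrw_transient (tree_adj (agw_children N)) x)"
proof
  note Z = assms(3) pmf_1_less_1[OF assms(2)]
  show "AE N in GW_measure Z. \<forall>x\<in>tree_vertices N. lcrw_transient (tree_adj N) x"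
    by (rule AE_GW_transient[OF Z measurable_ident_sets[OF refl]]) auto
  have "AE N in GW_measure Z. \<forall>x\<in>tree_vertices (agw_children N).
              lcrw_transient (tree_adj (agw_children N)) x"
  proof (rule AE_GW_transient[OF Z agw_children_measurable])
    \<comment> \<open>The only modified count is that of the root, which is an ancestor of every
      \<open>x\<close>.\<close>
    show "agw_children (override_on N' N (ancestors x)) = override_on N' (agw_children N) (ancestors x)"
      for x N N'
      by (auto simp: agw_children_def override_on_def fun_eq_iff ancestors_def)
  qed (auto simp: agw_children_def)
  then show "AE N in UGW_measure Z. \<forall>x\<in>tree_vertices (agw_children N).
              lcrw_transient (tree_adj (agw_children N)) x"
    \<comment> \<open>The unimodular law has a density with respect to the augmented one, so null
      sets carry over; \<open>root_degree_agw\<close> makes this density visibly measurable.\<close>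
    unfolding UGW_measure_def AGW_measure_def root_degree_agw
    by (subst AE_density) auto
qed

end
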